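(* Let $k>0$. For any $k$-Hadamard operator $A:L^1(\mathbb{R})\to L^\infty(\mathbb{R})$, any function $f:\mathbb{R}\to\mathbb{C}$ that is doubly $L^1$ for $A$, and any $1<q\le\infty$, \[ V(f)\,V(Af)\ \ge\ C_q\,k^{3-2/q}\,\|f\|_q^2\,\|Af\|_q^2, \] where $C_q=2^{-\frac{10q-8}{q-1}}$ (with $C_\infty=2^{-10}$). In particular, for every $f\in L^1(\mathbb{R})$ with Fourier transform $\hat f\in L^1(\mathbb{R})$ and every $1<q\le\infty$, $V(f)\,V(\hat f)\ge C_q\,\|f\|_q^2\,\|\hat f\|_q^2$.
   Context: Norms are with respect to Lebesgue measure on $\mathbb{R}$. For a function $g$, $V(g)=\int_{\mathbb{R}}x^2|g(x)|^2\,dx\in[0,\infty]$. Given a linear operator $A:L^1(\mathbb{R})\to L^\infty(\mathbb{R})$, a function $f$ is called doubly $L^1$ for $A$ if $f\in L^1(\mathbb{R})$ and $Af\in L^1(\mathbb{R})$. The operator $A$ is called $k$-Hadamard if $\|A\|_{1\to\infty}\le 1$ (i.e. $\|Af\|_\infty\le\|f\|_1$ for all $f\in L^1(\mathbb{R})$) and $\|A^*Af\|_\infty\ge k\|f\|_\infty$ for all $f$ that are doubly $L^1$ for $A$. Here $A^*:L^1(\mathbb{R})\to L^\infty(\mathbb{R})$ is the adjoint, determined by $\int (Af)\,\overline{g}\,dx=\int f\,\overline{A^*g}\,dx$ for all $f,g\in L^1(\mathbb{R})$. The Fourier transform is $\hat f(\xi)=\int f(x)e^{-2\pi i x\xi}\,dx$.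 Expressions in $q$ are interpreted by taking limits when $q=\infty$. *)

theory Defs
  imports "HOL-Analysis.Analysis" "HOL-Probability.Essential_Supremum"
begin

text \<open>Elements of \<open>L\<^sup>p(\<real>)\<close> are represented by functions \<open>real \<Rightarrow> complex\<close>, identified
  when they agree almost everywhere with respect to Lebesgue measure. Norms and variances
  are extended non-negative reals, so they are meaningful also when infinite.\<close>

definition variance_on_R :: "(real \<Rightarrow> complex) \<Rightarrow> ennreal" where
  "variance_on_R g = (\<integral>\<^sup>+ x. ennreal (x\<^sup>2 * (norm (g x))\<^sup>2) \<partial>lebesgue)"

text \<open>Meant for exponents \<open>1 \<le> q \<le> \<infinity>\<close>. The case distinction on the integral supplies the
  missing power function on \<^typ>\<open>ennreal\<close>.\<close>

definition Lq_norm :: "ereal \<Rightarrow> (real \<Rightarrow> complex) \<Rightarrow> ennreal" where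
  "Lq_norm q f =
     (if q = \<infinity> then esssup lebesgue (\<lambda>x. ennreal (norm (f x)))
      else let r = real_of_ereal q;
               I = (\<integral>\<^sup>+ x. ennreal (norm (f x) powr r) \<partial>lebesgue)
           in if I = \<infinity> then \<infinity> else ennreal (enn2real I powr (1 / r)))"

definition L1_space :: "(real \<Rightarrow> complex) set" where
  "L1_space = {f. integrable lebesgue f}"

definition Linf_space :: "(real \<Rightarrow> complex) set" where
  "Linf_space = {f. f \<in> borel_measurable lebesgue \<and> Lq_norm \<infinity> f < \<infinity>}"

text \<open>A linear operator on classes of functions modulo almost-everywhere equality, given on
  representatives: it must respect that equality and be linear up to null sets.
  The values of \<open>A\<close> outside \<^term>\<open>L1_space\<close> are irrelevant.\<close>

definition linear_L1_Linf :: "((real \<Rightarrow> complex) \<Rightarrow> (real \<Rightarrow> complex)) \<Rightarrow> bool" where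
  "linear_L1_Linf A \<longleftrightarrow>
     (\<forall>f\<in>L1_space. A f \<in> Linf_space) \<and>
     (\<forall>f\<in>L1_space. \<forall>g\<in>L1_space.
        (AE x in lebesgue. f x = g x) \<longrightarrow> (AE x in lebesgue. A f x = A g x)) \<and>
     (\<forall>f\<in>L1_space. \<forall>g\<in>L1_space. AE x in lebesgue. A (\<lambda>t. f t + g t) x = A f x + A g x) \<and>
     (\<forall>c. \<forall>f\<in>L1_space. AE x in lebesgue. A (\<lambda>t. c * f t) x = c * A f x)"

text \<open>For bounded \<open>A\<close> the adjoint exists because \<open>L\<^sup>\<infinity>\<close> is the dual of \<open>L\<^sup>1\<close>; its value at each
  \<open>g\<close> is determined up to a null set, so the choice of representatives is immaterial.\<close>

definition adjoint_L1_Linf ::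
  "((real \<Rightarrow> complex) \<Rightarrow> (real \<Rightarrow> complex)) \<Rightarrow> ((real \<Rightarrow> complex) \<Rightarrow> (real \<Rightarrow> complex))" where
  "adjoint_L1_Linf A =
     (SOME B. (\<forall>g\<in>L1_space. B g \<in> Linf_space) \<and>
        (\<forall>f\<in>L1_space. \<forall>g\<in>L1_space.
           (LINT x|lebesgue. A f x * cnj (g x)) = (LINT x|lebesgue. f x * cnj (B g x))))"

definition doubly_L1 ::
  "((real \<Rightarrow> complex) \<Rightarrow> (real \<Rightarrow> complex)) \<Rightarrow> (real \<Rightarrow> complex) \<Rightarrow> bool" where
  "doubly_L1 A f \<longleftrightarrow> f \<in> L1_space \<and> A f \<in> L1_space"

definition hadamard :: "real \<Rightarrow> ((real \<Rightarrow> complex) \<Rightarrow> (real \<Rightarrow> complex)) \<Rightarrow> bool" where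
  "hadamard k A \<longleftrightarrow>
     linear_L1_Linf A \<and>
     (\<forall>f\<in>L1_space. Lq_norm \<infinity> (A f) \<le> Lq_norm 1 f) \<and>
     (\<forall>f. doubly_L1 A f \<longrightarrow>
        Lq_norm \<infinity> (adjoint_L1_Linf A (A f)) \<ge> ennreal k * Lq_norm \<infinity> f)"

definition fourier :: "(real \<Rightarrow> complex) \<Rightarrow> (real \<Rightarrow> complex)" where
  "fourier f \<xi> = (LINT x|lebesgue. f x * exp (- 2 * of_real pi * \<i> * of_real x * of_real \<xi>))"

text \<open>The values at \<open>q = \<infinity>\<close> of the next two functions are the limits of the finite case.\<close>

definition C_const :: "ereal \<Rightarrow> real" where
  "C_const q = (if q = \<infinity> then 2 powr (- 10)
     else let r = real_of_ereal q in 2 powr (- ((10 * r - 8) / (r - 1))))"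

definition k_exponent :: "ereal \<Rightarrow> real" where
  "k_exponent q = (if q = \<infinity> then 3 else 3 - 2 / real_of_ereal q)"

end

theory Submission
  imports Defs "HOL-Probability.Characteristic_Functions" "HOL-Real_Asymp.Real_Asymp"
begin

text \<open>The inequality is a statement about two integrable functions \<open>f\<close> and \<open>g\<close>, each of which is
  bounded by the \<open>L\<^sup>1\<close> norm of the other: \<open>\<bar>g\<bar> \<le> \<parallel>f\<parallel>\<^sub>1\<close> and \<open>k \<bar>f\<bar> \<le> \<parallel>g\<parallel>\<^sub>1\<close> almost everywhere.

  Let \<open>p\<close> be the conjugate exponent of \<open>q\<close>. By Hoelder, \<open>f\<close> has mass at most
  \<open>(2 T)\<^bsup>1/p\<^esup> \<parallel>f\<parallel>\<^sub>q\<close> on \<open>{-T..T}\<close>. Choose \<open>T\<close> so that this is half of \<open>\<parallel>f\<parallel>\<^sub>1\<close>; the other half lies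
  outside, and Cauchy--Schwarz against \<open>1 / \<bar>x\<bar>\<close> forces \<open>V(f) \<ge> \<parallel>f\<parallel>\<^sub>1\<^sup>2 / 16 (\<parallel>f\<parallel>\<^sub>1 / (2 \<parallel>f\<parallel>\<^sub>q))\<^sup>p\<close>
  (\<open>variance_ge_of_local_bound\<close>). Interpolating \<open>L\<^sup>q\<close> between \<open>L\<^sup>1\<close> and \<open>L\<^sup>\<infinity>\<close> and inserting the
  mutual bounds gives \<open>\<parallel>f\<parallel>\<^sub>1 \<parallel>g\<parallel>\<^sub>1 \<ge> k\<^bsup>1/p\<^esup> \<parallel>f\<parallel>\<^sub>q \<parallel>g\<parallel>\<^sub>q\<close>. Multiplying the two variance bounds and
  substituting this yields the claim with exactly the stated constant (\<open>variance_product_ge\<close>).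

  For a Hadamard operator with \<open>g = A f\<close> the first bound is contractivity of \<open>A\<close>, and the second is
  \<open>k \<parallel>f\<parallel>\<^sub>\<infinity> \<le> \<parallel>A\<^sup>* A f\<parallel>\<^sub>\<infinity> \<le> \<parallel>A f\<parallel>\<^sub>1\<close>. The last step needs that the adjoint, which is defined by
  choice, exists; this is the duality of \<open>L\<^sup>1\<close> and \<open>L\<^sup>\<infinity>\<close>, derived from the Radon--Nikodym theorem
  (\<open>L1_functional_representation\<close>, \<open>adjoint_L1_Linf_exists\<close>).

  For the Fourier transform the second bound with \<open>k = 1\<close> is usually read off from the inversion
  formula. It is shown here by convolving \<open>f\<close> with Gaussians, which the Fourier transform turns into
  integrals of the transform of \<open>f\<close> against a function of modulus at most 1
  (\<open>AE_norm_le_fourier_L1\<close>).\<close>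

section \<open>Bounded functionals on the space of integrable functions\<close>

text \<open>A Radon--Nikodym theorem for signed set functions that avoids the Hahn decomposition: adding
  \<open>C\<close> times the measure to \<open>\<nu>\<close> makes it nonnegative, and finite additivity together with
  domination by the measure yields countable additivity, so the theorem for measures applies; the
  density of \<open>\<nu>\<close> is the one obtained, lowered by the constant \<open>C\<close>.\<close>

lemma (in finite_measure) dominated_charge_density:
  fixes \<nu> :: "'a set \<Rightarrow> real"
  assumes add: "\<And>A B. A \<in> sets M \<Longrightarrow> B \<in> sets M \<Longrightarrow> A \<inter> B = {} \<Longrightarrow> \<nu> (A \<union> B) = \<nu> A + \<nu> B"
    and bound: "\<And>A. A \<in> sets M \<Longrightarrow> \<bar>\<nu> A\<bar> \<le> C * measure M A"
  obtains h where "integrable M h" "\<And>A. A \<in> sets M \<Longrightarrow> \<nu> A = (LINT x:A|M. h x)"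
proof -
  define \<mu> where "\<mu> A = \<nu> A + C * measure M A" for A
  have mu: "0 \<le> \<mu> A" "\<mu> A \<le> 2 * C * measure M A" if "A \<in> sets M" for A
    using bound[OF that] by (auto simp: \<mu>_def)
  have mu_add: "\<mu> (A \<union> B) = \<mu> A + \<mu> B" if "A \<in> sets M" "B \<in> sets M" "A \<inter> B = {}" for A B
    using add[OF that] that by (simp add: \<mu>_def finite_measure_Union algebra_simps)
  define K where "K = measure_of (space M) (sets M) (\<lambda>A. ennreal (\<mu> A))"
  have pos: "positive (sets M) (\<lambda>A. ennreal (\<mu> A))"
    using mu[of "{}"] by (auto simp: positive_def)
  have ca: "countably_additive (sets M) (\<lambda>A. ennreal (\<mu> A))"
  proof (rule sets.empty_continuous_imp_countably_additive[OF pos])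
    show "additive (sets M) (\<lambda>A. ennreal (\<mu> A))"
      using mu mu_add by (auto simp: additive_def ennreal_plus[symmetric] simp del: ennreal_plus)
    show "\<forall>A\<in>sets M. ennreal (\<mu> A) \<noteq> \<infinity>" by simp
    fix A :: "nat \<Rightarrow> 'a set" assume A: "range A \<subseteq> sets M" "decseq A" "(\<Inter>i. A i) = {}"
    have "(\<lambda>i. measure M (A i)) \<longlonglongrightarrow> measure M (\<Inter>i. A i)"
      using A by (intro finite_Lim_measure_decseq) auto
    then have lim: "(\<lambda>i. 2 * C * measure M (A i)) \<longlonglongrightarrow> 0"
      using A by (auto intro!: tendsto_eq_intros)
    have "(\<lambda>i. \<mu> (A i)) \<longlonglongrightarrow> 0"
    proof (rule tendsto_sandwich[OF _ _ tendsto_const lim])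
      show "\<forall>\<^sub>F i in sequentially. 0 \<le> \<mu> (A i)" "\<forall>\<^sub>F i in sequentially. \<mu> (A i) \<le> 2 * C * measure M (A i)"
        using mu A(1) by (auto intro!: always_eventually)
    qed
    then show "(\<lambda>i. ennreal (\<mu> (A i))) \<longlonglongrightarrow> 0"
      by (simp add: tendsto_ennreal_iff[symmetric] tendsto_ennrealI flip: ennreal_0)
  qed
  have sK[simp, measurable_cong]: "sets K = sets M" "space K = space M"
    by (auto simp: K_def sets.space_closed sets.sets_measure_of_eq)
  have eK: "emeasure K A = ennreal (\<mu> A)" if "A \<in> sets M" for A
    using that pos ca unfolding K_def by (intro emeasure_measure_of_sigma) (auto simp: sets.sigma_algebra_axioms)
  have ac: "absolutely_continuous M K"
    unfolding absolutely_continuous_def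
  proof
    fix A assume "A \<in> null_sets M"
    then have "A \<in> sets M" "measure M A = 0" by (auto simp: measure_def)
    then have "emeasure K A = 0" using mu[of A] by (simp add: eK)
    then show "A \<in> null_sets K" using \<open>A \<in> sets M\<close> by (auto simp: null_sets_def)
  qed
  obtain D where D: "D \<in> borel_measurable M" "density M D = K"
    using Radon_Nikodym[OF ac sK(1)] by blast
  note [measurable] = D(1)
  have D': "(\<integral>\<^sup>+x\<in>A. D x \<partial>M) = ennreal (\<mu> A)" if "A \<in> sets M" for A
    using emeasure_density[OF D(1) that] D(2) eK[OF that] by simp
  have fin: "AE x in M. D x \<noteq> \<infinity>"
  proof (rule nn_integral_PInf_AE[OF D(1)])
    show "integral\<^sup>N M D \<noteq> \<infinity>"
      using D'[of "space M"] by (auto simp: nn_integral_set_ennreal cong: nn_integral_cong)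
  qed
  define d where "d x = enn2real (D x)" for x
  have [measurable]: "d \<in> borel_measurable M" unfolding d_def by measurable
  have dD: "AE x in M. ennreal (d x) = D x"
    using fin by eventually_elim (auto simp: d_def top.not_eq_extremum)
  have d0: "d x \<ge> 0" for x by (simp add: d_def)
  have d_set: "(\<integral>\<^sup>+x. ennreal (indicator A x * d x) \<partial>M) = ennreal (\<mu> A)" if "A \<in> sets M" for A
  proof -
    have "(\<integral>\<^sup>+x. ennreal (indicator A x * d x) \<partial>M) = (\<integral>\<^sup>+x\<in>A. D x \<partial>M)"
      using dD by (intro nn_integral_cong_AE) (auto split: split_indicator)
    then show ?thesis using D'[OF that] by simp
  qed
  have "(\<integral>\<^sup>+x. ennreal (d x) \<partial>M) = (\<integral>\<^sup>+x. ennreal (indicator (space M) x * d x) \<partial>M)"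
    by (intro nn_integral_cong) auto
  then have intd: "integrable M d"
    using d_set[of "space M"] d0 by (intro integrableI_nonneg) auto
  have int: "integrable M (\<lambda>x. d x - C)" using intd by auto
  moreover have "\<nu> A = (LINT x:A|M. d x - C)" if A: "A \<in> sets M" for A
  proof -
    have "has_bochner_integral M (\<lambda>x. indicator A x * d x) (\<mu> A)"
      using A d0 d_set[OF A] mu[OF A] by (intro has_bochner_integral_nn_integral) auto
    then have 1: "(LINT x:A|M. d x) = \<mu> A" by (simp add: has_bochner_integral_iff set_lebesgue_integral_def)
    have "(LINT x:A|M. d x - C) = (LINT x:A|M. d x) - (LINT x:A|M. C)"
      using integrable_mult_indicator[OF A intd] integrable_mult_indicator[OF A, of "\<lambda>_. C"]
      by (intro set_integral_diff) (auto simp: set_integrable_def)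
    also have "\<dots> = \<nu> A" using A by (simp add: 1 \<mu>_def set_integral_const emeasure_eq_measure)
    finally show ?thesis ..
  qed
  ultimately show ?thesis using that by blast
qed

text \<open>The dual of \<open>L\<^sup>1\<close> is \<open>L\<^sup>\<infinity>\<close>. An indicator function need not be integrable here, so \<open>M\<close>
  is first replaced by a finite measure \<open>N\<close> with a positive density \<open>w\<close>. On \<open>N\<close> the set
  functions given by the real and imaginary parts of \<open>\<phi>\<close> at \<open>w\<close> times an indicator are dominated by
  the measure, hence have densities; the averaging theorem turns the bound on sets into the
  pointwise bound, and approximation by simple functions extends the formula to all of \<open>L\<^sup>1\<close>.\<close>

lemma (in sigma_finite_measure) L1_functional_representation:
  fixes \<phi> :: "('a \<Rightarrow> complex) \<Rightarrow> complex"
  assumes add: "\<And>f g. integrable M f \<Longrightarrow> integrable M g \<Longrightarrow> \<phi> (\<lambda>x. f x + g x) = \<phi> f + \<phi> g"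
    and scale: "\<And>c f. integrable M f \<Longrightarrow> \<phi> (\<lambda>x. c * f x) = c * \<phi> f"
    and bound: "\<And>f. integrable M f \<Longrightarrow> norm (\<phi> f) \<le> C * (LINT x|M. norm (f x))"
  obtains h where "h \<in> borel_measurable M" "AE x in M. norm (h x) \<le> C"
    "\<And>f. integrable M f \<Longrightarrow> \<phi> f = (LINT x|M. f x * h x)"
proof -
  have diff: "\<phi> (\<lambda>x. f x - g x) = \<phi> f - \<phi> g" if "integrable M f" "integrable M g" for f g
    using that add[of f "\<lambda>x. -1 * g x"] scale[of g "-1"] by simp
  obtain w' where w': "w' \<in> borel_measurable M" "integral\<^sup>N M w' \<noteq> \<infinity>"
    "\<And>x. x \<in> space M \<Longrightarrow> 0 < w' x \<and> w' x < \<infinity>"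
    using Ex_finite_integrable_function by auto
  define w where "w x = enn2real (w' x)" for x
  have w_m[measurable]: "w \<in> borel_measurable M" using w'(1) unfolding w_def by measurable
  have w0: "w x \<ge> 0" for x by (simp add: w_def)
  have wpos: "w x > 0" if "x \<in> space M" for x
    using w'(3)[OF that] by (simp add: w_def enn2real_positive_iff)
  have ww: "(\<integral>\<^sup>+x. ennreal (w x) \<partial>M) = integral\<^sup>N M w'"
    using w'(3) by (intro nn_integral_cong) (auto simp: w_def)
  have w_int: "integrable M w" using w0 w'(2) ww by (intro integrableI_nonneg) (auto simp: top.not_eq_extremum)
  define N where "N = density M (\<lambda>x. ennreal (w x))"
  have sN[simp, measurable_cong]: "sets N = sets M" "space N = space M" by (auto simp: N_def)
  interpret N: finite_measure N
    using ww w'(2) by (intro finite_measureI) (auto simp: N_def emeasure_density cong: nn_integral_cong)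
  have intN: "integrable N u \<longleftrightarrow> integrable M (\<lambda>x. w x * u x)" if "u \<in> borel_measurable M" for u :: "'a \<Rightarrow> complex"
    using that integrable_density[of u M w] w0 unfolding N_def
    by (simp add: scaleR_conv_of_real)
  have integN: "(LINT x|N. u x) = (LINT x|M. w x * u x)" if "u \<in> borel_measurable M" for u :: "'a \<Rightarrow> complex"
    using that integral_density[of u M w] w0 unfolding N_def
    by (simp add: scaleR_conv_of_real)
  have indN: "integrable M (\<lambda>x. complex_of_real (w x) * indicator A x)" if "A \<in> sets M" for A
  proof -
    have "(\<lambda>x. complex_of_real (w x) * indicator A x) = (\<lambda>x. indicator A x *\<^sub>R complex_of_real (w x))"
      by (auto simp: fun_eq_iff split: split_indicator)
    then show ?thesis using that w_int integrable_mult_indicator[of A M "\<lambda>x. complex_of_real (w x)"] by simp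
  qed
  define \<nu> where "\<nu> A = \<phi> (\<lambda>x. complex_of_real (w x) * indicator A x)" for A
  have nu_add: "\<nu> (A \<union> B) = \<nu> A + \<nu> B" if "A \<in> sets M" "B \<in> sets M" "A \<inter> B = {}" for A B
  proof -
    have "(\<lambda>x. complex_of_real (w x) * indicator (A \<union> B) x) = (\<lambda>x. complex_of_real (w x) * indicator A x + complex_of_real (w x) * indicator B x)"
      using that by (auto simp: fun_eq_iff split: split_indicator)
    then show ?thesis unfolding \<nu>_def using add[OF indN indN] that by simp
  qed
  have nu_bound: "norm (\<nu> A) \<le> C * measure N A" if A: "A \<in> sets M" for A
  proof -
    have "measure N A = (LINT x|M. w x * indicator A x)"
      using A w0 integral_density[of "indicat_real A" M w] unfolding N_def[symmetric] by simp
    moreover have "norm (complex_of_real (w x) * indicator A x) = w x * indicator A x" for x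
      using w0[of x] by (auto split: split_indicator)
    ultimately show ?thesis unfolding \<nu>_def using bound[OF indN[OF A]] by simp
  qed
  obtain h1 where h1: "integrable N h1" "\<And>A. A \<in> sets M \<Longrightarrow> Re (\<nu> A) = (LINT x:A|N. h1 x)"
    using nu_add nu_bound
    by (rule_tac N.dominated_charge_density[of "\<lambda>A. Re (\<nu> A)" C]) (auto intro: order_trans[OF abs_Re_le_cmod])
  obtain h2 where h2: "integrable N h2" "\<And>A. A \<in> sets M \<Longrightarrow> Im (\<nu> A) = (LINT x:A|N. h2 x)"
    using nu_add nu_bound
    by (rule_tac N.dominated_charge_density[of "\<lambda>A. Im (\<nu> A)" C]) (auto intro: order_trans[OF abs_Im_le_cmod])
  define h where "h x = complex_of_real (h1 x) + \<i> * complex_of_real (h2 x)" for x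
  have h_int: "integrable N h" unfolding h_def using h1 h2 by auto
  then have h_m[measurable]: "h \<in> borel_measurable M" by (auto dest: borel_measurable_integrable)
  have h_set: "(LINT x:A|N. h x) = \<nu> A" if A: "A \<in> sets M" for A
  proof -
    have i1: "integrable N (\<lambda>x. indicator A x * h1 x)" "integrable N (\<lambda>x. indicator A x * h2 x)"
      using integrable_mult_indicator[of A N h1] integrable_mult_indicator[of A N h2] h1(1) h2(1) A by auto
    have "(LINT x:A|N. h x) = (LINT x|N. complex_of_real (indicator A x * h1 x) + \<i> * complex_of_real (indicator A x * h2 x))"
      unfolding set_lebesgue_integral_def h_def
      by (intro Bochner_Integration.integral_cong refl) (simp add: scaleR_conv_of_real distrib_left mult.left_commute)
    also have "\<dots> = complex_of_real (LINT x|N. indicator A x * h1 x) + \<i> * complex_of_real (LINT x|N. indicator A x * h2 x)"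
      using i1 by (subst Bochner_Integration.integral_add) (auto simp del: of_real_mult)
    also have "\<dots> = \<nu> A" using h1(2)[OF A] h2(2)[OF A] by (simp add: set_lebesgue_integral_def complex_eq_iff)
    finally show ?thesis .
  qed
  \<comment> \<open>Averages of \<open>h\<close> over sets of positive measure lie in the disc of radius \<open>C\<close>.\<close>
  have AE_N: "AE x in N. h x \<in> cball 0 C"
  proof (rule N.averaging_theorem[OF h_int])
    fix A assume A: "A \<in> sets N" "measure N A > 0"
    then show "(1 / measure N A) *\<^sub>R (LINT x:A|N. h x) \<in> cball 0 C"
      using nu_bound[of A] by (simp add: h_set field_simps)
  qed simp
  have hC: "AE x in M. norm (h x) \<le> C"
    using AE_N unfolding N_def by (subst (asm) AE_density) (auto elim!: AE_mp simp: wpos)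
  have hN: "AE x in N. norm (h x) \<le> C" using AE_N by simp
  have bi: "integrable N (\<lambda>x. u x * h x)" if u: "integrable N u" for u :: "'a \<Rightarrow> complex"
  proof (rule Bochner_Integration.integrable_bound)
    show "integrable N (\<lambda>x. C * norm (u x))" using u by simp
    show "(\<lambda>x. u x * h x) \<in> borel_measurable N" using u h_int by simp
    show "AE x in N. norm (u x * h x) \<le> norm (C * norm (u x))"
      using hN
    proof eventually_elim
      fix x assume "norm (h x) \<le> C"
      then have "norm (u x * h x) \<le> C * norm (u x)"
        using mult_right_mono[of "norm (h x)" C "norm (u x)"] by (simp add: norm_mult mult.commute)
      then show "norm (u x * h x) \<le> norm (C * norm (u x))" by simp
    qed
  qed
  \<comment> \<open>Integrable functions for \<open>M\<close> are exactly \<open>w\<close> times integrable functions for \<open>N\<close>, so this is the whole claim.\<close>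
  have P: "\<phi> (\<lambda>x. w x * u x) = (LINT x|N. u x * h x)" if "integrable N u" for u :: "'a \<Rightarrow> complex"
    using that
  proof (induct rule: integrable_induct)
    case (base A c)
    have "(\<lambda>x. complex_of_real (w x) * (indicator A x *\<^sub>R c)) = (\<lambda>x. c * (complex_of_real (w x) * indicator A x))"
      by (auto simp: fun_eq_iff split: split_indicator)
    then have "\<phi> (\<lambda>x. w x * (indicator A x *\<^sub>R c)) = c * \<nu> A"
      using scale[OF indN[of A]] base by (simp add: \<nu>_def)
    also have "\<dots> = c * (LINT x:A|N. h x)" using base by (simp add: h_set)
    also have "\<dots> = (LINT x|N. c * (indicator A x *\<^sub>R h x))" by (simp add: set_lebesgue_integral_def mult_scaleR_right del: integral_mult_right integral_mult_right_zero flip: integral_mult_right_zero)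
    also have "\<dots> = (LINT x|N. indicator A x *\<^sub>R c * h x)"
      by (intro Bochner_Integration.integral_cong) auto
    finally show ?case .
  next
    case (add f g)
    have [measurable]: "f \<in> borel_measurable M" "g \<in> borel_measurable M"
      using add(1,3) by (auto dest: borel_measurable_integrable)
    have "\<phi> (\<lambda>x. w x * (f x + g x)) = \<phi> (\<lambda>x. w x * f x) + \<phi> (\<lambda>x. w x * g x)"
      using add(1,3) assms(1)[of "\<lambda>x. w x * f x" "\<lambda>x. w x * g x"] by (simp add: intN distrib_left)
    then show ?case using add bi by (simp add: distrib_right)
  next
    case (lim f s)
    have sm[measurable]: "s i \<in> borel_measurable M" for i
      using lim(1)[of i] by (auto dest: borel_measurable_integrable)
    have [measurable]: "f \<in> borel_measurable M"
      using lim(5) by (auto dest: borel_measurable_integrable)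
    have wf: "integrable M (\<lambda>x. w x * f x)" "\<And>i. integrable M (\<lambda>x. w x * s i x)"
      using lim by (auto simp flip: intN)
    have "(\<lambda>i. LINT x|N. s i x * h x) \<longlonglongrightarrow> (LINT x|N. f x * h x)"
    proof (rule integral_dominated_convergence[where w="\<lambda>x. 2 * C * norm (f x)"])
      show "integrable N (\<lambda>x. 2 * C * norm (f x))" using lim by auto
      show "AE x in N. (\<lambda>i. s i x * h x) \<longlonglongrightarrow> f x * h x" using lim by (auto intro!: tendsto_intros AE_I2)
      show "AE x in N. norm (s i x * h x) \<le> 2 * C * norm (f x)" for i
        using hN
        proof (rule AE_mp, intro AE_I2 impI)
          fix x assume "x \<in> space N" "norm (h x) \<le> C"
          then show "norm (s i x * h x) \<le> 2 * C * norm (f x)"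
            using mult_mono[of "norm (s i x)" "2 * norm (f x)" "norm (h x)" C] lim(4)[of x i]
            by (simp add: norm_mult mult_ac)
        qed
    qed measurable
    moreover have "(\<lambda>i. \<phi> (\<lambda>x. w x * s i x)) \<longlonglongrightarrow> \<phi> (\<lambda>x. w x * f x)"
    proof -
      have d: "norm (\<phi> (\<lambda>x. w x * s i x) - \<phi> (\<lambda>x. w x * f x)) \<le> C * (LINT x|M. norm (w x * s i x - w x * f x))" for i
        using bound[of "\<lambda>x. w x * s i x - w x * f x"] wf by (simp add: diff)
      have "(\<lambda>i. LINT x|M. norm (w x * s i x - w x * f x)) \<longlonglongrightarrow> (LINT x|M. (0::real))"
      proof (rule integral_dominated_convergence[where w="\<lambda>x. 3 * norm (w x * f x)"])
        show "integrable M (\<lambda>x. 3 * norm (w x * f x))" using wf by auto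
        show "AE x in M. (\<lambda>i. norm (w x * s i x - w x * f x)) \<longlonglongrightarrow> 0"
          using lim(3) by (intro AE_I2 tendsto_norm_zero LIM_zero tendsto_intros) auto
        show "AE x in M. norm (norm (w x * s i x - w x * f x)) \<le> 3 * norm (w x * f x)" for i
        proof (intro AE_I2)
          fix x assume x: "x \<in> space M"
          have "norm (w x * s i x - w x * f x) \<le> norm (w x * s i x) + norm (w x * f x)" by (rule norm_triangle_ineq4)
          also have "norm (w x * s i x) \<le> 2 * norm (w x * f x)"
            using lim(4)[of x i] x w0[of x] mult_left_mono[of "norm (s i x)" "2 * norm (f x)" "w x"] by (simp add: norm_mult)
          finally show "norm (norm (w x * s i x - w x * f x)) \<le> 3 * norm (w x * f x)" by simp
        qed
      qed measurable
      then have "(\<lambda>i. C * (LINT x|M. norm (w x * s i x - w x * f x))) \<longlonglongrightarrow> 0"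
        by (auto intro!: tendsto_eq_intros)
      then have "(\<lambda>i. \<phi> (\<lambda>x. w x * s i x) - \<phi> (\<lambda>x. w x * f x)) \<longlonglongrightarrow> 0"
        by (rule Lim_null_comparison[OF always_eventually, rotated]) (use d in auto)
      then show ?thesis by (rule LIM_zero_cancel)
    qed
    ultimately show ?case using lim(2) LIMSEQ_unique by simp
  qed
  have "\<phi> f = (LINT x|M. f x * h x)" if f: "integrable M f" for f
  proof -
    have [measurable]: "f \<in> borel_measurable M" using f by auto
    define u where "u x = f x / w x" for x
    have [measurable]: "u \<in> borel_measurable M" unfolding u_def by measurable
    have wu: "w x * u x = f x" if "x \<in> space M" for x using wpos[OF that] by (simp add: u_def)
    have iu: "integrable N u" using f wu by (simp add: intN cong: Bochner_Integration.integrable_cong)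
    have iwu: "integrable M (\<lambda>x. w x * u x)" using iu by (simp add: intN)
    have "norm (\<phi> (\<lambda>x. f x - w x * u x)) \<le> C * (LINT x|M. norm (f x - w x * u x))"
      using f iwu by (intro bound) auto
    also have "(LINT x|M. norm (f x - w x * u x)) = (LINT x|M. (0::real))"
      by (intro Bochner_Integration.integral_cong) (auto simp: wu)
    finally have "\<phi> f = \<phi> (\<lambda>x. w x * u x)" using f iwu by (simp add: diff)
    also have "\<dots> = (LINT x|M. w x * (u x * h x))" using P[OF iu] by (simp add: integN)
    also have "\<dots> = (LINT x|M. f x * h x)"
      by (intro Bochner_Integration.integral_cong) (auto simp: wu[symmetric])
    finally show ?thesis .
  qed
  with hC h_m show ?thesis using that by blast
qed

section \<open>Contractions from integrable to bounded functions and their adjoints\<close>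

lemma borel_measurable_cnj [measurable (raw)]:
  "f \<in> borel_measurable M \<Longrightarrow> (\<lambda>x. cnj (f x)) \<in> borel_measurable M"
  by (rule borel_measurable_continuous_on[OF continuous_on_cnj[OF continuous_on_id]])

lemma sigma_finite_lebesgue: "sigma_finite_measure (lebesgue :: 'a::euclidean_space measure)"
proof
  show "\<exists>A::'a set set. countable A \<and> A \<subseteq> sets lebesgue \<and> \<Union> A = space lebesgue \<and> (\<forall>a\<in>A. emeasure lebesgue a \<noteq> \<infinity>)"
  proof (intro exI conjI)
    show "countable (range (\<lambda>n::nat. ball (0::'a) (real n)))" by simp
    show "\<Union> (range (\<lambda>n::nat. ball (0::'a) (real n))) = space lebesgue"
      using reals_Archimedean2 by auto
    show "\<forall>a\<in>range (\<lambda>n::nat. ball (0::'a) (real n)). emeasure lebesgue a \<noteq> \<infinity>"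
      using emeasure_bounded_finite[of "ball (0::'a) _"] by (auto simp: less_top[symmetric])
  qed auto
qed

text \<open>The averaging theorem wants an integrable function; cutting off to \<open>{-n..n}\<close> makes it
  available for functions that are only locally integrable, such as bounded ones. Both sup-norm
  bounds below, for the adjoint and for functions with integrable Fourier transform, come from here.\<close>

lemma AE_lebesgue_norm_le_of_set_averages:
  fixes f :: "real \<Rightarrow> complex"
  assumes loc: "\<And>n::nat. integrable lebesgue (\<lambda>x. indicator {-real n..real n} x *\<^sub>R f x)"
    and avg: "\<And>A. A \<in> sets lebesgue \<Longrightarrow> bounded A \<Longrightarrow>
      norm (LINT x:A|lebesgue. f x) \<le> C * measure lebesgue A"
    and C: "C \<ge> 0"
  shows "AE x in lebesgue. norm (f x) \<le> C"
proof -
  interpret sigma_finite_measure "lebesgue :: real measure" by (rule sigma_finite_lebesgue)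
  have "AE x in lebesgue. indicator {-real n..real n} x *\<^sub>R f x \<in> cball 0 C" for n
  proof (rule averaging_theorem[OF loc])
    fix A :: "real set" assume A: "A \<in> sets lebesgue" "measure lebesgue A > 0"
    define A' where "A' = A \<inter> {-real n..real n}"
    have A': "A' \<in> sets lebesgue" "bounded A'" using A by (auto simp: A'_def)
    have "(LINT x:A|lebesgue. indicator {-real n..real n} x *\<^sub>R f x) = (LINT x:A'|lebesgue. f x)"
      unfolding set_lebesgue_integral_def A'_def by (intro Bochner_Integration.integral_cong) (auto split: split_indicator)
    also have "norm \<dots> \<le> C * measure lebesgue A'" by (rule avg[OF A'])
    also have "emeasure lebesgue A \<noteq> \<infinity>" using A(2) by (auto simp: measure_def)
    then have "measure lebesgue A' \<le> measure lebesgue A"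
      using A A' by (intro measure_mono_fmeasurable fmeasurableI) (auto simp: A'_def top.not_eq_extremum)
    then have "C * measure lebesgue A' \<le> C * measure lebesgue A" using C by (rule mult_left_mono)
    finally show "(1 / measure lebesgue A) *\<^sub>R (LINT x:A|lebesgue. indicator {-real n..real n} x *\<^sub>R f x) \<in> cball 0 C"
      using A(2) by (simp add: field_simps)
  qed simp
  then have "AE x in lebesgue. \<forall>n. indicator {-real n..real n} x *\<^sub>R f x \<in> cball 0 C"
    by (simp add: AE_all_countable)
  then show ?thesis
  proof eventually_elim
    fix x assume *: "\<forall>n. indicator {-real n..real n} x *\<^sub>R f x \<in> cball 0 C"
    obtain n :: nat where "\<bar>x\<bar> \<le> real n" using real_arch_simple by blast
    then have "x \<in> {-real n..real n}" by auto
    then show "norm (f x) \<le> C" using *[rule_format, of n] by simp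
  qed
qed

lemma Linf_norm_le_iff:
  assumes [measurable]: "f \<in> borel_measurable lebesgue" and c: "c \<ge> 0"
  shows "Lq_norm \<infinity> f \<le> ennreal c \<longleftrightarrow> (AE x in lebesgue. norm (f x) \<le> c)"
proof
  assume *: "Lq_norm \<infinity> f \<le> ennreal c"
  have "AE x in lebesgue. ennreal (norm (f x)) \<le> Lq_norm \<infinity> f"
    unfolding Lq_norm_def using esssup_AE[where f="\<lambda>x. ennreal (norm (f x))"] by simp
  then show "AE x in lebesgue. norm (f x) \<le> c"
    by eventually_elim (use * c in \<open>auto dest: order_trans simp: ennreal_le_iff\<close>)
next
  assume "AE x in lebesgue. norm (f x) \<le> c"
  then have "AE x in lebesgue. ennreal (norm (f x)) \<le> ennreal c"
    by eventually_elim (rule ennreal_leI)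
  then show "Lq_norm \<infinity> f \<le> ennreal c"
    unfolding Lq_norm_def by (simp add: esssup_I)
qed

lemma L1_norm_eq_integral:
  assumes "integrable lebesgue f"
  shows "Lq_norm 1 f = ennreal (LINT x|lebesgue. norm (f x))"
proof -
  have "(\<integral>\<^sup>+x. ennreal (norm (f x) powr 1) \<partial>lebesgue) = ennreal (LINT x|lebesgue. norm (f x))"
    using assms by (simp add: nn_integral_eq_integral)
  then show ?thesis by (simp add: Lq_norm_def Let_def)
qed

lemma Linf_spaceE:
  assumes "g \<in> Linf_space"
  obtains c where "c \<ge> 0" "g \<in> borel_measurable lebesgue" "AE x in lebesgue. norm (g x) \<le> c"
proof (rule that)
  have g: "g \<in> borel_measurable lebesgue" "Lq_norm \<infinity> g < \<infinity>"
    using assms by (auto simp: Linf_space_def)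
  then have "Lq_norm \<infinity> g \<le> ennreal (enn2real (Lq_norm \<infinity> g))" by simp
  then show "AE x in lebesgue. norm (g x) \<le> enn2real (Lq_norm \<infinity> g)"
    using Linf_norm_le_iff[OF g(1)] by simp
qed (use assms in \<open>auto simp: Linf_space_def\<close>)

lemma integrable_mult_AE_bounded:
  fixes f g :: "'a \<Rightarrow> complex"
  assumes f: "integrable M f" and g: "g \<in> borel_measurable M" and b: "AE x in M. norm (g x) \<le> c"
  shows "integrable M (\<lambda>x. f x * g x)"
proof (rule Bochner_Integration.integrable_bound)
  show "integrable M (\<lambda>x. c * norm (f x))" using f by simp
  show "(\<lambda>x. f x * g x) \<in> borel_measurable M" using f g by simp
  show "AE x in M. norm (f x * g x) \<le> norm (c * norm (f x))"
    using b
  proof eventually_elim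
    fix x assume "norm (g x) \<le> c"
    then have "norm (f x * g x) \<le> c * norm (f x)"
      using mult_right_mono[of "norm (g x)" c "norm (f x)"] by (simp add: norm_mult mult.commute)
    then show "norm (f x * g x) \<le> norm (c * norm (f x))" by simp
  qed
qed

lemma integral_mult_le_AE_bounded:
  fixes f g :: "'a \<Rightarrow> complex"
  assumes f: "integrable M f" and g: "g \<in> borel_measurable M" and b: "AE x in M. norm (g x) \<le> c"
  shows "norm (LINT x|M. f x * g x) \<le> c * (LINT x|M. norm (f x))"
proof -
  have "norm (LINT x|M. f x * g x) \<le> (LINT x|M. norm (f x * g x))" by (rule integral_norm_bound)
  also have "\<dots> \<le> (LINT x|M. c * norm (f x))"
  proof (rule integral_mono_AE)
    show "integrable M (\<lambda>x. norm (f x * g x))" using integrable_mult_AE_bounded[OF assms] by simp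
    show "integrable M (\<lambda>x. c * norm (f x))" using f by simp
    show "AE x in M. norm (f x * g x) \<le> c * norm (f x)"
      using b by eventually_elim (simp add: norm_mult, metis mult.commute mult_right_mono norm_ge_zero)
  qed
  finally show ?thesis by simp
qed

text \<open>The property whose chosen witness is \<^const>\<open>adjoint_L1_Linf\<close>.\<close>

definition is_adjoint_L1_Linf where
  "is_adjoint_L1_Linf A B \<longleftrightarrow> (\<forall>g\<in>L1_space. B g \<in> Linf_space) \<and>
        (\<forall>f\<in>L1_space. \<forall>g\<in>L1_space.
           (LINT x|lebesgue. A f x * cnj (g x)) = (LINT x|lebesgue. f x * cnj (B g x)))"

lemma pairing_bound:
  assumes lin: "linear_L1_Linf A" and contr: "\<forall>f\<in>L1_space. Lq_norm \<infinity> (A f) \<le> Lq_norm 1 f"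
    and f: "integrable lebesgue f" and g: "integrable lebesgue g"
  shows "norm (LINT x|lebesgue. A f x * cnj (g x)) \<le>
    (LINT x|lebesgue. norm (g x)) * (LINT x|lebesgue. norm (f x))"
    and "integrable lebesgue (\<lambda>x. A f x * cnj (g x))"
proof -
  have fL: "f \<in> L1_space" using f by (simp add: L1_space_def)
  then have Am: "A f \<in> borel_measurable lebesgue" using lin by (auto simp: linear_L1_Linf_def Linf_space_def)
  have "AE x in lebesgue. norm (A f x) \<le> (LINT x|lebesgue. norm (f x))"
    using contr[rule_format, OF fL] Linf_norm_le_iff[OF Am, of "LINT x|lebesgue. norm (f x)"]
    by (simp add: L1_norm_eq_integral[OF f])
  from integral_mult_le_AE_bounded[OF _ Am this, of "\<lambda>x. cnj (g x)"]
    integrable_mult_AE_bounded[OF _ Am this, of "\<lambda>x. cnj (g x)"]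
  show "norm (LINT x|lebesgue. A f x * cnj (g x)) \<le>
    (LINT x|lebesgue. norm (g x)) * (LINT x|lebesgue. norm (f x))"
    "integrable lebesgue (\<lambda>x. A f x * cnj (g x))"
    using g by (simp_all add: mult.commute)
qed

text \<open>Without existence nothing would be known about the chosen adjoint. For fixed \<open>g\<close> the pairing of
  \<open>A f\<close> with \<open>g\<close> is a bounded functional of \<open>f\<close>, so it is represented by a bounded function, whose
  conjugate serves as the value of the adjoint at \<open>g\<close>.\<close>

lemma adjoint_L1_Linf_exists:
  assumes lin: "linear_L1_Linf A" and contr: "\<forall>f\<in>L1_space. Lq_norm \<infinity> (A f) \<le> Lq_norm 1 f"
  shows "\<exists>B. is_adjoint_L1_Linf A B"
proof -
  interpret sigma_finite_measure "lebesgue :: real measure" by (rule sigma_finite_lebesgue)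
  have Am[measurable]: "A f \<in> borel_measurable lebesgue" if "integrable lebesgue f" for f
    using that lin by (auto simp: linear_L1_Linf_def Linf_space_def L1_space_def)
  have "\<exists>b\<in>Linf_space. \<forall>f\<in>L1_space.
      (LINT x|lebesgue. A f x * cnj (g x)) = (LINT x|lebesgue. f x * cnj (b x))"
    if g: "g \<in> L1_space" for g
  proof -
    have gi: "integrable lebesgue g" using g by (simp add: L1_space_def)
    then have [measurable]: "g \<in> borel_measurable lebesgue" by simp
    define \<phi> where "\<phi> f = (LINT x|lebesgue. A f x * cnj (g x))" for f
    obtain h where h: "h \<in> borel_measurable lebesgue"
      "AE x in lebesgue. norm (h x) \<le> (LINT x|lebesgue. norm (g x))"
      "\<And>f. integrable lebesgue f \<Longrightarrow> \<phi> f = (LINT x|lebesgue. f x * h x)"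
    proof (rule L1_functional_representation[of \<phi>])
      fix f1 f2 :: "real \<Rightarrow> complex" assume f: "integrable lebesgue f1" "integrable lebesgue f2"
      then have "AE x in lebesgue. A (\<lambda>t. f1 t + f2 t) x = A f1 x + A f2 x"
        using lin by (auto simp: linear_L1_Linf_def L1_space_def)
      then have "\<phi> (\<lambda>x. f1 x + f2 x) = (LINT x|lebesgue. A f1 x * cnj (g x) + A f2 x * cnj (g x))"
        using f gi Am[of f1] Am[of f2] Am[of "\<lambda>t. f1 t + f2 t"] unfolding \<phi>_def
        by (intro integral_cong_AE) (auto simp: distrib_right intro!: borel_measurable_cnj borel_measurable_times borel_measurable_add elim!: eventually_mono)
      then show "\<phi> (\<lambda>x. f1 x + f2 x) = \<phi> f1 + \<phi> f2"
        using f pairing_bound(2)[OF lin contr _ gi] by (simp add: \<phi>_def)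
    next
      fix c and f :: "real \<Rightarrow> complex" assume f: "integrable lebesgue f"
      then have "AE x in lebesgue. A (\<lambda>t. c * f t) x = c * A f x"
        using lin by (auto simp: linear_L1_Linf_def L1_space_def)
      then have "\<phi> (\<lambda>x. c * f x) = (LINT x|lebesgue. c * (A f x * cnj (g x)))"
        using f gi Am[of f] Am[of "\<lambda>t. c * f t"] unfolding \<phi>_def
        by (intro integral_cong_AE) (auto intro!: borel_measurable_cnj borel_measurable_times borel_measurable_add elim!: eventually_mono)
      then show "\<phi> (\<lambda>x. c * f x) = c * \<phi> f" by (simp add: \<phi>_def)
    next
      fix f :: "real \<Rightarrow> complex" assume f: "integrable lebesgue f"
      show "norm (\<phi> f) \<le> (LINT x|lebesgue. norm (g x)) * (LINT x|lebesgue. norm (f x))"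
        unfolding \<phi>_def by (rule pairing_bound[OF lin contr f gi])
    qed (rule that)
    show ?thesis
    proof (intro bexI ballI)
      have "Lq_norm \<infinity> (\<lambda>x. cnj (h x)) \<le> ennreal (LINT x|lebesgue. norm (g x))"
        using h by (subst Linf_norm_le_iff) auto
      then show "(\<lambda>x. cnj (h x)) \<in> Linf_space"
        using h by (auto simp: Linf_space_def intro: le_less_trans)
    qed (use h(3) in \<open>simp add: L1_space_def \<phi>_def\<close>)
  qed
  then obtain B where "\<And>g. g \<in> L1_space \<Longrightarrow> B g \<in> Linf_space \<and> (\<forall>f\<in>L1_space.
      (LINT x|lebesgue. A f x * cnj (g x)) = (LINT x|lebesgue. f x * cnj (B g x)))"
    by metis
  then show ?thesis unfolding is_adjoint_L1_Linf_def by blast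
qed

text \<open>Testing the adjoint relation on indicator functions of bounded sets bounds the averages of
  \<open>adjoint_L1_Linf A g\<close> by the \<open>L\<^sup>1\<close> norm of \<open>g\<close>; any choice of adjoint is therefore a contraction.\<close>

lemma adjoint_L1_Linf_contraction:
  assumes lin: "linear_L1_Linf A" and contr: "\<forall>f\<in>L1_space. Lq_norm \<infinity> (A f) \<le> Lq_norm 1 f"
    and g: "g \<in> L1_space"
  shows "Lq_norm \<infinity> (adjoint_L1_Linf A g) \<le> Lq_norm 1 g"
proof -
  define b where "b = adjoint_L1_Linf A g"
  have "is_adjoint_L1_Linf A (adjoint_L1_Linf A)"
    using someI_ex[OF adjoint_L1_Linf_exists[OF lin contr]]
    unfolding is_adjoint_L1_Linf_def adjoint_L1_Linf_def .
  then have b: "b \<in> Linf_space" and adj: "\<And>f. integrable lebesgue f \<Longrightarrow>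
      (LINT x|lebesgue. A f x * cnj (g x)) = (LINT x|lebesgue. f x * cnj (b x))"
    using g by (auto simp: is_adjoint_L1_Linf_def b_def L1_space_def)
  have gi: "integrable lebesgue g" using g by (simp add: L1_space_def)
  obtain c where c: "b \<in> borel_measurable lebesgue" "AE x in lebesgue. norm (b x) \<le> c"
    using b by (rule Linf_spaceE)
  define C where "C = (LINT x|lebesgue. norm (g x))"
  have ind: "integrable lebesgue (\<lambda>x. complex_of_real (indicator A x))" "emeasure lebesgue A < \<infinity>"
    if A: "A \<in> sets lebesgue" "bounded A" for A :: "real set"
  proof -
    have "A \<in> lmeasurable" using A by (simp add: bounded_set_imp_lmeasurable)
    then show "emeasure lebesgue A < \<infinity>" by (auto simp: fmeasurable_def simp del: emeasure_completion)
    then show "integrable lebesgue (\<lambda>x. complex_of_real (indicator A x))"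
      using A by (intro integrable_of_real integrable_real_indicator) auto
  qed
  have "AE x in lebesgue. norm (cnj (b x)) \<le> C"
  proof (rule AE_lebesgue_norm_le_of_set_averages)
    fix n :: nat
    show "integrable lebesgue (\<lambda>x. indicator {- real n..real n} x *\<^sub>R cnj (b x))"
      using integrable_mult_AE_bounded[OF ind(1) borel_measurable_cnj[OF c(1)], of "{- real n..real n}" c] c
      by (simp add: scaleR_conv_of_real)
  next
    fix A :: "real set" assume A: "A \<in> sets lebesgue" "bounded A"
    have "(LINT x:A|lebesgue. cnj (b x)) = (LINT x|lebesgue. A' x * cnj (b x))"
      if "A' = (\<lambda>x. complex_of_real (indicator A x))" for A'
      using that by (simp add: set_lebesgue_integral_def scaleR_conv_of_real)
    then have "norm (LINT x:A|lebesgue. cnj (b x)) \<le> C * (LINT x|lebesgue. norm (complex_of_real (indicator A x)))"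
      using pairing_bound(1)[OF lin contr ind(1)[OF A] gi] adj[OF ind(1)[OF A]] by (simp add: C_def)
    also have "(LINT x|lebesgue. norm (complex_of_real (indicator A x))) = measure lebesgue A"
      using A by simp
    finally show "norm (LINT x:A|lebesgue. cnj (b x)) \<le> C * measure lebesgue A" .
  qed (simp add: C_def)
  then show ?thesis
    using Linf_norm_le_iff[OF c(1), of C] L1_norm_eq_integral[OF gi] by (simp add: b_def C_def)
qed

text \<open>All that the inequality uses about a Hadamard operator: each of \<open>f\<close> and \<open>A f\<close> is bounded by the
  \<open>L\<^sup>1\<close> norm of the other. The second bound combines the lower bound on \<open>A\<^sup>* A f\<close> with the
  contractivity of \<open>A\<^sup>*\<close>, applied to the integrable function \<open>A f\<close>.\<close>

lemma hadamard_bounds: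
  assumes k: "k > 0" and A: "hadamard k A" and f: "doubly_L1 A f"
  shows "AE x in lebesgue. norm (A f x) \<le> (LINT x|lebesgue. norm (f x))"
    and "AE x in lebesgue. norm (f x) \<le> (LINT x|lebesgue. norm (A f x)) / k"
proof -
  have fi: "integrable lebesgue f" "integrable lebesgue (A f)" "f \<in> L1_space" "A f \<in> L1_space"
    using f by (auto simp: doubly_L1_def L1_space_def)
  have lin: "linear_L1_Linf A" and contr: "\<forall>f\<in>L1_space. Lq_norm \<infinity> (A f) \<le> Lq_norm 1 f"
    and had: "ennreal k * Lq_norm \<infinity> f \<le> Lq_norm \<infinity> (adjoint_L1_Linf A (A f))"
    using A f by (auto simp: hadamard_def)
  show "AE x in lebesgue. norm (A f x) \<le> (LINT x|lebesgue. norm (f x))"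
    using contr fi by (subst Linf_norm_le_iff[symmetric]) (auto simp: L1_norm_eq_integral)
  have "ennreal k * Lq_norm \<infinity> f \<le> ennreal (LINT x|lebesgue. norm (A f x))"
    using order_trans[OF had adjoint_L1_Linf_contraction[OF lin contr fi(4)]] L1_norm_eq_integral[OF fi(2)] by simp
  then have "ennreal (1/k) * (ennreal k * Lq_norm \<infinity> f) \<le> ennreal (1/k) * ennreal (LINT x|lebesgue. norm (A f x))"
    by (rule mult_left_mono) simp
  also have "ennreal (1/k) * (ennreal k * Lq_norm \<infinity> f) = Lq_norm \<infinity> f"
    using k by (simp add: mult.assoc[symmetric] ennreal_mult[symmetric] )
  also have "ennreal (1/k) * ennreal (LINT x|lebesgue. norm (A f x)) = ennreal ((LINT x|lebesgue. norm (A f x)) / k)"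
    using k by (simp add: ennreal_mult[symmetric])
  finally show "AE x in lebesgue. norm (f x) \<le> (LINT x|lebesgue. norm (A f x)) / k"
    using k fi by (subst Linf_norm_le_iff[symmetric]) auto
qed

section \<open>Variance, norms, and the product inequality\<close>

text \<open>The Hoelder conjugate \<open>p\<close> of \<open>q\<close>. In terms of \<open>p\<close> the constants of the inequality take the
  same form for finite and infinite \<open>q\<close>, which lets both cases be treated at once.\<close>

definition conj_exponent :: "ereal \<Rightarrow> real" where
  "conj_exponent q = (if q = \<infinity> then 1 else real_of_ereal q / (real_of_ereal q - 1))"

lemma exponents_via_conj:
  assumes "1 < q"
  shows "conj_exponent q > 0" "C_const q = 2 powr (- (8 + 2 * conj_exponent q))"
    "k_exponent q = 1 + 2 / conj_exponent q"
proof -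
  have "conj_exponent q > 0 \<and> C_const q = 2 powr (- (8 + 2 * conj_exponent q)) \<and> k_exponent q = 1 + 2 / conj_exponent q"
  proof (cases q)
    case (real r)
    then have "r > 1" using assms by simp
    then have "(10 * r - 8) / (r - 1) = 8 + 2 * (r / (r - 1))" "3 - 2 / r = 1 + 2 / (r / (r - 1))"
      by (simp_all add: field_simps)
    then show ?thesis using real \<open>r > 1\<close> by (simp add: conj_exponent_def C_const_def k_exponent_def Let_def)
  qed (use assms in \<open>auto simp: conj_exponent_def C_const_def k_exponent_def\<close>)
  then show "conj_exponent q > 0" "C_const q = 2 powr (- (8 + 2 * conj_exponent q))"
    "k_exponent q = 1 + 2 / conj_exponent q" by auto
qed

lemma nn_integral_inverse_square_tail:
  fixes T :: real
  assumes T: "T > 0"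
  shows "(\<integral>\<^sup>+x. ennreal (1 / x\<^sup>2) * indicator (- {-T..T}) x \<partial>lborel) \<le> ennreal (2 / T)"
proof -
  have tail: "(\<integral>\<^sup>+x. ennreal (1 / x\<^sup>2) * indicator {T..} x \<partial>lborel) = ennreal (1 / T)"
  proof -
    have "(\<integral>\<^sup>+x. ennreal (1 / x\<^sup>2) * indicator {T..} x \<partial>lborel) = ennreal (0 - (- 1 / T))"
    proof (rule nn_integral_FTC_atLeast)
      fix x :: real assume "T \<le> x"
      then have "x \<noteq> 0" using T by auto
      then show "((\<lambda>x. - 1 / x) has_real_derivative 1 / x\<^sup>2) (at x)"
        by (auto intro!: derivative_eq_intros simp: power2_eq_square)
      show "0 \<le> 1 / x\<^sup>2" by simp
    next
      show "((\<lambda>x::real. - 1 / x) \<longlongrightarrow> 0) at_top" by real_asymp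
    qed measurable
    then show ?thesis by simp
  qed
  have "(\<integral>\<^sup>+x. ennreal (1 / x\<^sup>2) * indicator {..-T} x \<partial>lborel) =
      (\<integral>\<^sup>+x. ennreal (1 / x\<^sup>2) * indicator {T..} x \<partial>lborel)"
    by (subst nn_integral_real_affine[of _ "-1" 0])
      (auto intro!: nn_integral_cong split: split_indicator)
  then have "ennreal (1 / T) + ennreal (1 / T) = (\<integral>\<^sup>+x. ennreal (1 / x\<^sup>2) * indicator {T..} x \<partial>lborel) +
     (\<integral>\<^sup>+x. ennreal (1 / x\<^sup>2) * indicator {..-T} x \<partial>lborel)"
    by (simp add: tail)
  also have "\<dots> = (\<integral>\<^sup>+x. ennreal (1 / x\<^sup>2) * indicator {T..} x + ennreal (1 / x\<^sup>2) * indicator {..-T} x \<partial>lborel)"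
    by (intro nn_integral_add[symmetric]) auto
  also have "\<dots> \<ge> (\<integral>\<^sup>+x. ennreal (1 / x\<^sup>2) * indicator (- {-T..T}) x \<partial>lborel)"
    by (intro nn_integral_mono) (auto split: split_indicator)
  finally show ?thesis using T by (simp add: ennreal_plus[symmetric] del: ennreal_plus)
qed

text \<open>Cauchy--Schwarz for \<open>\<bar>f x\<bar> = (\<bar>x\<bar> \<bar>f x\<bar>) (1 / \<bar>x\<bar>)\<close> on the complement of \<open>{-T..T}\<close>.\<close>

lemma variance_ge_tail_mass:
  assumes f: "integrable lebesgue f" and T: "T > 0"
  shows "ennreal ((LINT x:-{-T..T}|lebesgue. norm (f x))\<^sup>2 * T / 2) \<le> variance_on_R f"
proof -
  have [measurable]: "f \<in> borel_measurable lebesgue" using f by simp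
  have [measurable]: "(\<lambda>x::real. \<bar>x\<bar>) \<in> borel_measurable lebesgue"
    "(\<lambda>x. ennreal (1 / \<bar>x\<bar>) * indicator (-{-T..T}) x) \<in> borel_measurable lebesgue"
    by (intro measurable_completion; measurable)+
  define m where "m = (LINT x:-{-T..T}|lebesgue. norm (f x))"
  have m0: "m \<ge> 0" unfolding m_def set_lebesgue_integral_def by simp
  have int: "integrable lebesgue (\<lambda>x. indicator (-{-T..T}) x *\<^sub>R norm (f x))"
    using f by (intro integrable_mult_indicator) auto
  have "(\<integral>\<^sup>+x. ennreal (\<bar>x\<bar> * norm (f x)) * (ennreal (1 / \<bar>x\<bar>) * indicator (-{-T..T}) x) \<partial>lebesgue) =
      (\<integral>\<^sup>+x. ennreal (indicator (-{-T..T}) x *\<^sub>R norm (f x)) \<partial>lebesgue)"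
    using T by (intro nn_integral_cong) (auto split: split_indicator simp: ennreal_mult[symmetric])
  also have "\<dots> = ennreal m"
    using int unfolding m_def set_lebesgue_integral_def by (intro nn_integral_eq_integral) auto
  finally have "(ennreal m)\<^sup>2 \<le> (\<integral>\<^sup>+x. (ennreal (\<bar>x\<bar> * norm (f x)))\<^sup>2 \<partial>lebesgue) *
      (\<integral>\<^sup>+x. (ennreal (1 / \<bar>x\<bar>) * indicator (-{-T..T}) x)\<^sup>2 \<partial>lebesgue)"
    using Cauchy_Schwarz_nn_integral[of "\<lambda>x. ennreal (\<bar>x\<bar> * norm (f x))" lebesgue
        "\<lambda>x. ennreal (1 / \<bar>x\<bar>) * indicator (-{-T..T}) x"] by simp
  also have "(\<integral>\<^sup>+x. (ennreal (\<bar>x\<bar> * norm (f x)))\<^sup>2 \<partial>lebesgue) = variance_on_R f"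
    unfolding variance_on_R_def by (intro nn_integral_cong) (simp add: ennreal_power power_mult_distrib)
  also have "(\<integral>\<^sup>+x. (ennreal (1 / \<bar>x\<bar>) * indicator (-{-T..T}) x)\<^sup>2 \<partial>lebesgue) =
      (\<integral>\<^sup>+x. ennreal (1 / x\<^sup>2) * indicator (- {-T..T}) x \<partial>lborel)"
    unfolding nn_integral_completion
    by (intro nn_integral_cong) (auto split: split_indicator simp: ennreal_power power_divide)
  also have "\<dots> \<le> ennreal (2 / T)" by (rule nn_integral_inverse_square_tail[OF T])
  finally have "(ennreal m)\<^sup>2 \<le> variance_on_R f * ennreal (2 / T)" by (simp add: mult_left_mono)
  then have "(ennreal m)\<^sup>2 * ennreal (T / 2) \<le> variance_on_R f * ennreal (2 / T) * ennreal (T / 2)"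
    by (rule mult_right_mono) simp
  also have "\<dots> = variance_on_R f * ennreal (2 / T * (T / 2))"
    using T by (subst ennreal_mult) (auto simp: mult.assoc)
  also have "2 / T * (T / 2) = 1" using T by simp
  also have "(ennreal m)\<^sup>2 * ennreal (T / 2) = ennreal (m\<^sup>2 * T / 2)"
    using m0 T by (simp add: ennreal_power ennreal_mult[symmetric])
  finally show ?thesis by (simp add: m_def)
qed

text \<open>If a function cannot put much mass on a short interval around the origin, then it has a large
  variance.\<close>

lemma variance_ge_of_local_bound:
  assumes f: "integrable lebesgue f" and N: "N = (LINT x|lebesgue. norm (f x))" "N > 0"
    and Q: "Q > 0" and p: "p > 0"
    and loc: "\<And>T. T > 0 \<Longrightarrow> (LINT x:{-T..T}|lebesgue. norm (f x)) \<le> (2 * T) powr (1 / p) * Q"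
  shows "ennreal (N\<^sup>2 / 16 * (N / (2 * Q)) powr p) \<le> variance_on_R f"
proof -
  \<comment> \<open>The interval on which the local bound permits exactly half of the mass.\<close>
  define T where "T = (N / (2 * Q)) powr p / 2"
  have T: "T > 0" using N Q by (simp add: T_def)
  have "(2 * T) powr (1 / p) = N / (2 * Q)" using N Q p by (simp add: T_def powr_powr)
  then have "(LINT x:{-T..T}|lebesgue. norm (f x)) \<le> N / 2" using loc[OF T] Q by simp
  moreover have "N = (LINT x:{-T..T}|lebesgue. norm (f x)) + (LINT x:-{-T..T}|lebesgue. norm (f x))"
  proof -
    have i: "integrable lebesgue (\<lambda>x. indicator A x *\<^sub>R norm (f x))" if "A \<in> sets lebesgue" for A
      using f that by (intro integrable_mult_indicator) auto
    have "N = (LINT x|lebesgue. indicator {-T..T} x *\<^sub>R norm (f x) + indicator (-{-T..T}) x *\<^sub>R norm (f x))"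
      unfolding N by (intro Bochner_Integration.integral_cong) (auto split: split_indicator)
    then show ?thesis
      unfolding set_lebesgue_integral_def using i by (subst (asm) Bochner_Integration.integral_add) auto
  qed
  ultimately have "N / 2 \<le> (LINT x:-{-T..T}|lebesgue. norm (f x))" by simp
  then have "(N / 2)\<^sup>2 * T / 2 \<le> (LINT x:-{-T..T}|lebesgue. norm (f x))\<^sup>2 * T / 2"
    using N T by (intro divide_right_mono mult_right_mono power_mono) auto
  then have "ennreal ((N / 2)\<^sup>2 * T / 2) \<le> variance_on_R f"
    using variance_ge_tail_mass[OF f T] by (meson ennreal_leI order_trans)
  also have "(N / 2)\<^sup>2 * T / 2 = N\<^sup>2 / 16 * (N / (2 * Q)) powr p" by (simp add: T_def power_divide)
  finally show ?thesis .
qed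

lemma Lq_norm_AE_zero:
  assumes f: "f \<in> borel_measurable lebesgue" "AE x in lebesgue. f x = 0" and q: "1 < q"
  shows "Lq_norm q f = 0"
proof (cases q)
  case (real r)
  have "(\<integral>\<^sup>+ x. ennreal (norm (f x) powr r) \<partial>lebesgue) = (\<integral>\<^sup>+ x. 0 \<partial>(lebesgue :: real measure))"
    using f(2) by (intro nn_integral_cong_AE) (auto elim!: eventually_mono)
  then show ?thesis using real by (simp add: Lq_norm_def Let_def)
next
  case PInf
  then show ?thesis using Linf_norm_le_iff[OF f(1), of 0] f(2) by simp
qed (use q in auto)

text \<open>The upper bound on \<open>I\<close> is interpolation between \<open>L\<^sup>1\<close> and \<open>L\<^sup>\<infinity>\<close>; the bound on \<open>{-T..T}\<close> is
  Hoelder's inequality against the constant function 1, obtained by integrating Young's inequality.\<close>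

lemma Lr_norm_interpolation:
  fixes f :: "real \<Rightarrow> complex"
  assumes f: "integrable lebesgue f" and N: "N = (LINT x|lebesgue. norm (f x))" "N > 0"
    and M: "M \<ge> 0" "AE x in lebesgue. norm (f x) \<le> M" and r: "r > 1"
  obtains I where "I > 0" "(\<integral>\<^sup>+x. ennreal (norm (f x) powr r) \<partial>lebesgue) = ennreal I"
    "I \<le> M powr (r - 1) * N"
    "\<And>T. T > 0 \<Longrightarrow> (LINT x:{-T..T}|lebesgue. norm (f x)) \<le> (2 * T) powr (1 - 1 / r) * I powr (1 / r)"
proof -
  have [measurable]: "f \<in> borel_measurable lebesgue" using f by simp
  have pw: "AE x in lebesgue. norm (f x) powr r \<le> M powr (r - 1) * norm (f x)"
    using M(2)
  proof eventually_elim
    fix x assume *: "norm (f x) \<le> M"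
    show "norm (f x) powr r \<le> M powr (r - 1) * norm (f x)"
    proof (cases "f x = 0")
      case False
      have "norm (f x) powr r = norm (f x) powr (r - 1) * norm (f x)"
        using False powr_add[of "norm (f x)" "r - 1" 1] by simp
      also have "\<dots> \<le> M powr (r - 1) * norm (f x)"
        using * r by (intro mult_right_mono powr_mono2) auto
      finally show ?thesis .
    qed (use r in simp)
  qed
  have int: "integrable lebesgue (\<lambda>x. norm (f x) powr r)"
    by (rule Bochner_Integration.integrable_bound[of _ "\<lambda>x. M powr (r - 1) * norm (f x)"])
      (use f pw in \<open>auto elim!: eventually_mono\<close>)
  define I where "I = (LINT x|lebesgue. norm (f x) powr r)"
  have I1: "(\<integral>\<^sup>+x. ennreal (norm (f x) powr r) \<partial>lebesgue) = ennreal I"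
    unfolding I_def using int by (intro nn_integral_eq_integral) auto
  have I2: "I \<le> M powr (r - 1) * N"
  proof -
    have "I \<le> (LINT x|lebesgue. M powr (r - 1) * norm (f x))"
      unfolding I_def using int f pw by (intro integral_mono_AE) auto
    then show ?thesis by (simp add: N)
  qed
  have I0: "I > 0"
  proof (rule ccontr)
    assume "\<not> I > 0"
    then have "I = 0" unfolding I_def by (simp add: not_less antisym)
    then have "AE x in lebesgue. norm (f x) powr r = 0"
      unfolding I_def using int by (subst (asm) integral_nonneg_eq_0_iff_AE) auto
    then have "(LINT x|lebesgue. norm (f x)) = (LINT x|(lebesgue :: real measure). (0::real))"
      using f by (intro integral_cong_AE) (auto elim!: eventually_mono)
    then show False using N by simp
  qed
  have loc: "(LINT x:{-T..T}|lebesgue. norm (f x)) \<le> (2 * T) powr (1 - 1 / r) * I powr (1 / r)"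
    if T: "T > 0" for T
  proof -
    \<comment> \<open>Young's inequality is applied to \<open>norm (f x) / c\<close> and 1; this \<open>c\<close> makes the integrated bound optimal.\<close>
    define c where "c = (I / (2 * T)) powr (1 / r)"
    have c: "c > 0" "c powr r = I / (2 * T)" using I0 T r by (auto simp: c_def powr_powr)
    have young: "norm (f x) \<le> c * ((1 / r) * (norm (f x) powr r / c powr r) + (1 - 1 / r))" for x
    proof -
      have "1 / r + 1 / (r / (r - 1)) = 1" "r / (r - 1) > 1" using r by (auto simp: field_simps)
      then have "norm (f x) / c * 1 \<le> (norm (f x) / c) powr r / r + 1 powr (r / (r - 1)) / (r / (r - 1))"
        using c r by (intro Youngs_inequality) auto
      also have "\<dots> = (1 / r) * (norm (f x) powr r / c powr r) + (1 - 1 / r)"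
        using c r by (simp add: powr_divide field_simps)
      finally show ?thesis using c by (simp add: field_simps)
    qed
    have i: "integrable lebesgue (\<lambda>x. indicator {-T..T} x *\<^sub>R g x)" if "integrable lebesgue g" for g :: "real \<Rightarrow> real"
      using that by (intro integrable_mult_indicator) auto
    have ind: "integrable lebesgue (indicat_real {-T..T})" "(LINT x|lebesgue. indicat_real {-T..T} x) = 2 * T"
      using T by auto
    have "(LINT x:{-T..T}|lebesgue. norm (f x)) \<le>
       (LINT x|lebesgue. c * ((1 / r) * ((norm (f x) powr r) / c powr r) + (1 - 1 / r) * indicator {-T..T} x))"
      unfolding set_lebesgue_integral_def
    proof (rule integral_mono)
      show "integrable lebesgue (\<lambda>x. indicator {-T..T} x *\<^sub>R norm (f x))" using f by (intro i) simp
      show "integrable lebesgue (\<lambda>x. c * ((1 / r) * ((norm (f x) powr r) / c powr r) + (1 - 1 / r) * indicator {-T..T} x))"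
        using int ind by (intro integrable_mult_right Bochner_Integration.integrable_add integrable_divide) auto
      show "indicator {-T..T} x *\<^sub>R norm (f x) \<le> c * ((1 / r) * ((norm (f x) powr r) / c powr r) + (1 - 1 / r) * indicator {-T..T} x)" for x
        using young[of x] c r I0 T by (auto split: split_indicator)
    qed
    also have "\<dots> = c * ((1 / r) * (I / c powr r) + (1 - 1 / r) * (2 * T))"
      using int ind by (subst integral_mult_right_zero, subst Bochner_Integration.integral_add) (auto simp: I_def)
    also have "\<dots> = c * (2 * T)" 
    proof -
      have "I / c powr r = 2 * T" using c(2) I0 T by simp
      then show ?thesis using r by (simp add: left_diff_distrib)
    qed
    also have "\<dots> = (2 * T) powr (1 - 1 / r) * I powr (1 / r)"
      using I0 T by (simp add: c_def powr_divide powr_diff)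
    finally show ?thesis .
  qed
  from I0 I1 I2 loc show ?thesis by (rule that)
qed

text \<open>The two facts about the \<open>L\<^sup>q\<close> norm \<open>Q\<close> that the argument needs, uniformly in \<open>q\<close>: it controls
  the mass on short intervals, and it is at most an interpolated product of the sup norm and the
  \<open>L\<^sup>1\<close> norm.\<close>

lemma Lq_norm_interpolation:
  fixes f :: "real \<Rightarrow> complex"
  assumes f: "integrable lebesgue f" and N: "N = (LINT x|lebesgue. norm (f x))" "N > 0"
    and M: "M \<ge> 0" "AE x in lebesgue. norm (f x) \<le> M" and q: "1 < q" and p: "p = conj_exponent q"
  obtains Q where "Q > 0" "Lq_norm q f = ennreal Q" "Q \<le> M powr (1 / p) * N powr (1 - 1 / p)"
    "\<And>T. T > 0 \<Longrightarrow> (LINT x:{-T..T}|lebesgue. norm (f x)) \<le> (2 * T) powr (1 / p) * Q"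
proof (cases q)
  case (real r)
  have r: "r > 1" using real q by simp
  have "p = r / (r - 1)" using r p real by (simp add: conj_exponent_def)
  then have p': "1 / p = 1 - 1 / r" using r by (simp add: diff_divide_distrib)
  from Lr_norm_interpolation[OF f N M r] obtain I where I: "I > 0"
    "(\<integral>\<^sup>+x. ennreal (norm (f x) powr r) \<partial>lebesgue) = ennreal I" "I \<le> M powr (r - 1) * N"
    "\<And>T. T > 0 \<Longrightarrow> (LINT x:{-T..T}|lebesgue. norm (f x)) \<le> (2 * T) powr (1 - 1 / r) * I powr (1 / r)"
    by blast
  show ?thesis
  proof (rule that[of "I powr (1 / r)"])
    show "Lq_norm q f = ennreal (I powr (1 / r))" using I real by (simp add: Lq_norm_def Let_def)
    have "I powr (1 / r) \<le> (M powr (r - 1) * N) powr (1 / r)"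
      using I r by (intro powr_mono2) auto
    also have "\<dots> = M powr (1 / p) * N powr (1 - 1 / p)"
      using M N r by (simp add: powr_mult powr_powr p' diff_divide_distrib)
    finally show "I powr (1 / r) \<le> M powr (1 / p) * N powr (1 - 1 / p)" .
  qed (use I p' in auto)
next
  case PInf
  have p1: "p = 1" using p PInf by (simp add: conj_exponent_def)
  have fm: "f \<in> borel_measurable lebesgue" using f by simp
  define Q where "Q = enn2real (Lq_norm \<infinity> f)"
  have le: "Lq_norm \<infinity> f \<le> ennreal M" using Linf_norm_le_iff[OF fm M(1)] M(2) by simp
  then have Q: "Lq_norm \<infinity> f = ennreal Q"
    unfolding Q_def using le_less_trans[OF le] by simp
  have Q0: "Q \<ge> 0" by (simp add: Q_def)
  have fQ: "AE x in lebesgue. norm (f x) \<le> Q" using Linf_norm_le_iff[OF fm Q0] Q by simp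
  show ?thesis
  proof (rule that[of Q])
    show "Q > 0"
    proof (rule ccontr)
      assume "\<not> Q > 0"
      with Q0 have "Q = 0" by simp
      then have "AE x in lebesgue. norm (f x) = 0" using fQ by (auto elim!: eventually_mono)
      then have "(LINT x|lebesgue. norm (f x)) = (LINT x|(lebesgue :: real measure). (0::real))"
        using f by (intro integral_cong_AE) auto
      then show False using N by simp
    qed
    show "Lq_norm q f = ennreal Q" using Q PInf by simp
    have "Q \<le> M" using le M(1) by (simp add: Q)
    then show "Q \<le> M powr (1 / p) * N powr (1 - 1 / p)" using M N p1 by simp
    fix T :: real assume T: "T > 0"
    have "(LINT x:{-T..T}|lebesgue. norm (f x)) \<le> (LINT x|lebesgue. Q * indicator {-T..T} x)"
      unfolding set_lebesgue_integral_def
    proof (rule integral_mono_AE)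
      show "integrable lebesgue (\<lambda>x. indicator {-T..T} x *\<^sub>R norm (f x))"
        using f by (intro integrable_mult_indicator) auto
      show "AE x in lebesgue. indicator {-T..T} x *\<^sub>R norm (f x) \<le> Q * indicator {-T..T} x"
        using fQ by eventually_elim (auto split: split_indicator)
      show "integrable lebesgue (\<lambda>x. Q * indicator {-T..T} x)"
        using T by (intro integrable_mult_right) auto
    qed
    also have "\<dots> = (2 * T) powr (1 / p) * Q" using T p1 by simp
    finally show "(LINT x:{-T..T}|lebesgue. norm (f x)) \<le> (2 * T) powr (1 / p) * Q" .
  qed
qed (use q in auto)

text \<open>Here \<open>a\<close>, \<open>b\<close> are the \<open>L\<^sup>1\<close> norms and \<open>c\<close>, \<open>d\<close> the \<open>L\<^sup>q\<close> norms of the two functions. The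
  hypotheses multiply to \<open>k powr (1 / p) * (c * d) \<le> a * b\<close>, while the right-hand side is a constant
  times \<open>(a * b) powr (2 + p) / (c * d) powr p\<close>.\<close>

lemma uncertainty_arithmetic:
  fixes a b c d k p :: real
  assumes pos: "a > 0" "b > 0" "c > 0" "d > 0" "k > 0" "p > 0"
    and c: "c \<le> (b / k) powr (1 / p) * a powr (1 - 1 / p)"
    and d: "d \<le> a powr (1 / p) * b powr (1 - 1 / p)"
  shows "2 powr (- (8 + 2 * p)) * k powr (1 + 2 / p) * c\<^sup>2 * d\<^sup>2 \<le>
    (a\<^sup>2 / 16 * (a / (2 * c)) powr p) * (b\<^sup>2 / 16 * (b / (2 * d)) powr p)"
proof -
  define y where "y = c * d"
  have y: "y > 0" using pos by (simp add: y_def)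
  have "y \<le> ((b / k) powr (1 / p) * a powr (1 - 1 / p)) * (a powr (1 / p) * b powr (1 - 1 / p))"
    unfolding y_def using c d pos by (intro mult_mono) auto
  also have "\<dots> = (a powr (1 / p) * a powr (1 - 1 / p)) * (b powr (1 / p) * b powr (1 - 1 / p)) / k powr (1 / p)"
    using pos by (simp add: powr_divide)
  also have "\<dots> = a * b / k powr (1 / p)"
    using pos by (simp flip: powr_add)
  finally have xy: "k powr (1 / p) * y \<le> a * b" using pos by (simp add: field_simps)
  have "k powr (1 + 2 / p) * y powr (2 + p) = (k powr (1 / p) * y) powr (2 + p)"
    using pos y by (simp add: powr_mult powr_powr add_divide_distrib distrib_left add.commute)
  also have "\<dots> \<le> (a * b) powr (2 + p)" using xy y pos by (intro powr_mono2) auto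
  finally have main: "k powr (1 + 2 / p) * y powr (2 + p) \<le> (a * b) powr (2 + p)" .
  have "2 powr (- (8 + 2 * p)) * k powr (1 + 2 / p) * c\<^sup>2 * d\<^sup>2 =
      2 powr (- (8 + 2 * p)) / y powr p * (k powr (1 + 2 / p) * y powr (2 + p))"
    using y by (simp add: powr_add y_def power_mult_distrib)
  also have "\<dots> \<le> 2 powr (- (8 + 2 * p)) / y powr p * (a * b) powr (2 + p)"
    using main by (intro mult_left_mono) auto
  also have "\<dots> = (a\<^sup>2 / 16 * (a / (2 * c)) powr p) * (b\<^sup>2 / 16 * (b / (2 * d)) powr p)"
  proof -
    have "(2::real) powr (- (8 + 2 * p)) = 1 / (256 * (2 powr p * 2 powr p))"
    proof -
      have "(2::real) powr (8 + 2 * p) = 2 powr 8 * (2 powr p * 2 powr p)"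
        unfolding powr_add[symmetric] by simp
      also have "(2::real) powr 8 = 256" by simp
      finally show ?thesis by (simp only: powr_minus inverse_eq_divide)
    qed
    then show ?thesis
      using pos by (simp add: y_def powr_add powr_mult powr_divide field_simps power2_eq_square)
  qed
  finally show ?thesis .
qed

text \<open>The uncertainty principle for two functions that bound each other. No operator is involved, so
  it serves both parts of the theorem.\<close>

lemma variance_product_ge:
  fixes f g :: "real \<Rightarrow> complex"
  assumes f: "integrable lebesgue f" and g: "integrable lebesgue g" and k: "k > 0" and q: "1 < q"
    and gf: "AE x in lebesgue. norm (g x) \<le> (LINT x|lebesgue. norm (f x))"
    and fg: "AE x in lebesgue. norm (f x) \<le> (LINT x|lebesgue. norm (g x)) / k"
  shows "ennreal (C_const q * k powr k_exponent q) * (Lq_norm q f)\<^sup>2 * (Lq_norm q g)\<^sup>2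
    \<le> variance_on_R f * variance_on_R g"
proof -
  define a where "a = (LINT x|lebesgue. norm (f x))"
  define b where "b = (LINT x|lebesgue. norm (g x))"
  have ab0: "a \<ge> 0" "b \<ge> 0" by (auto simp: a_def b_def)
  show ?thesis
  proof (cases "a = 0 \<or> b = 0")
    case True
    \<comment> \<open>A function that vanishes almost everywhere makes the left-hand side zero.\<close>
    then have "(AE x in lebesgue. f x = 0) \<or> (AE x in lebesgue. g x = 0)"
      using f g unfolding a_def b_def
      by (subst (asm) (1 2) integral_nonneg_eq_0_iff_AE) auto
    then have "Lq_norm q f = 0 \<or> Lq_norm q g = 0"
      using Lq_norm_AE_zero[OF borel_measurable_integrable[OF f] _ q]
        Lq_norm_AE_zero[OF borel_measurable_integrable[OF g] _ q] by blast
    then show ?thesis by auto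
  next
    case False
    then have ab: "a > 0" "b > 0" using ab0 by auto
    define p where "p = conj_exponent q"
    note e = exponents_via_conj[OF q, folded p_def]
    obtain c where c: "c > 0" "Lq_norm q f = ennreal c" "c \<le> (b / k) powr (1 / p) * a powr (1 - 1 / p)"
      "\<And>T. T > 0 \<Longrightarrow> (LINT x:{-T..T}|lebesgue. norm (f x)) \<le> (2 * T) powr (1 / p) * c"
      using Lq_norm_interpolation[OF f a_def ab(1) _ fg[folded b_def] q p_def] ab k by auto
    obtain d where d: "d > 0" "Lq_norm q g = ennreal d" "d \<le> a powr (1 / p) * b powr (1 - 1 / p)"
      "\<And>T. T > 0 \<Longrightarrow> (LINT x:{-T..T}|lebesgue. norm (g x)) \<le> (2 * T) powr (1 / p) * d"
      using Lq_norm_interpolation[OF g b_def ab(2) _ gf[folded a_def] q p_def] ab by auto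
    have "ennreal (C_const q * k powr k_exponent q) * (Lq_norm q f)\<^sup>2 * (Lq_norm q g)\<^sup>2 =
        ennreal (2 powr (- (8 + 2 * p)) * k powr (1 + 2 / p) * c\<^sup>2 * d\<^sup>2)"
      using c d by (simp add: e ennreal_power ennreal_mult)
    also have "\<dots> \<le> ennreal ((a\<^sup>2 / 16 * (a / (2 * c)) powr p) * (b\<^sup>2 / 16 * (b / (2 * d)) powr p))"
      using uncertainty_arithmetic[OF ab c(1) d(1) k e(1) c(3) d(3)] by (rule ennreal_leI)
    also have "\<dots> = ennreal (a\<^sup>2 / 16 * (a / (2 * c)) powr p) * ennreal (b\<^sup>2 / 16 * (b / (2 * d)) powr p)"
      by (intro ennreal_mult) auto
    also have "\<dots> \<le> variance_on_R f * variance_on_R g"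
      using variance_ge_of_local_bound[OF f a_def ab(1) c(1) e(1) c(4)]
        variance_ge_of_local_bound[OF g b_def ab(2) d(1) e(1) d(4)]
      by (intro mult_mono) auto
    finally show ?thesis .
  qed
qed

section \<open>The Fourier transform\<close>

text \<open>The integrability condition of Fubini's theorem, in the form in which both exchanges of integrals
  below satisfy it.\<close>

lemma (in pair_sigma_finite) integrable_pair_bound:
  fixes F :: "'a \<Rightarrow> 'b \<Rightarrow> complex" and a :: "'a \<Rightarrow> real" and b :: "'b \<Rightarrow> real"
  assumes F[measurable]: "case_prod F \<in> borel_measurable (M1 \<Otimes>\<^sub>M M2)"
    and a: "integrable M1 a" and b: "integrable M2 b"
    and le: "\<And>x y. norm (F x y) \<le> a x * b y"
  shows "integrable (M1 \<Otimes>\<^sub>M M2) (case_prod F)"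
proof (rule Bochner_Integration.integrable_bound)
  have [measurable]: "a \<in> borel_measurable M1" "b \<in> borel_measurable M2" using a b by auto
  show "integrable (M1 \<Otimes>\<^sub>M M2) (\<lambda>(x, y). a x * b y)"
  proof (rule Fubini_integrable)
    show "integrable M1 (\<lambda>x. LINT y|M2. norm (case (x, y) of (x, y) \<Rightarrow> a x * b y))"
      using a by (simp add: abs_mult)
    show "AE x in M1. integrable M2 (\<lambda>y. case (x, y) of (x, y) \<Rightarrow> a x * b y)"
      using b by simp
  qed measurable
  show "AE z in M1 \<Otimes>\<^sub>M M2. norm (case_prod F z) \<le> norm (case z of (x, y) \<Rightarrow> a x * b y)"
    using le by (auto intro!: AE_I2 order_trans[OF _ abs_ge_self])
qed (rule F)

lemma measurable_fst_snd_lebesgue_borel [measurable]: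
  "fst \<in> borel_measurable (lebesgue \<Otimes>\<^sub>M (M :: 'b measure))" "snd \<in> borel_measurable (M \<Otimes>\<^sub>M lebesgue)"
  using measurable_compose[OF measurable_fst measurable_completion[OF measurable_ident_sets[of lborel borel]]]
    measurable_compose[OF measurable_snd measurable_completion[OF measurable_ident_sets[of lborel borel]]]
  by auto

lemma borel_measurable_fourier:
  assumes f: "integrable lebesgue f"
  shows "fourier f \<in> borel_measurable borel"
proof -
  interpret sigma_finite_measure "lebesgue :: real measure" by (rule sigma_finite_lebesgue)
  have [measurable]: "f \<in> borel_measurable lebesgue" using f by simp
  have "(\<lambda>\<xi>. LINT x|lebesgue. f x * exp (- 2 * of_real pi * \<i> * of_real x * of_real \<xi>)) \<in> borel_measurable borel"
    by (rule borel_measurable_lebesgue_integral) measurable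
  then show ?thesis by (simp add: fourier_def[abs_def])
qed

lemma norm_fourier_le:
  assumes f: "integrable lebesgue f"
  shows "norm (fourier f \<xi>) \<le> (LINT x|lebesgue. norm (f x))"
proof -
  have "norm (fourier f \<xi>) \<le> (LINT x|lebesgue. norm (f x * exp (- 2 * of_real pi * \<i> * of_real x * of_real \<xi>)))"
    unfolding fourier_def by (rule integral_norm_bound)
  also have "\<dots> = (LINT x|lebesgue. norm (f x))" by (simp add: norm_mult)
  finally show ?thesis .
qed

text \<open>The Gaussian is the characteristic function of the standard normal distribution.\<close>

lemma gaussian_eq_fourier_integral:
  "complex_of_real (exp (- t\<^sup>2 / 2)) = (LINT \<eta>|lborel. std_normal_density \<eta> * iexp (t * \<eta>))"
proof -
  have "complex_of_real (exp (- t\<^sup>2 / 2)) = char std_normal_distribution t"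
    by (simp add: char_std_normal_distribution)
  also have "\<dots> = (LINT \<eta>|lborel. std_normal_density \<eta> *\<^sub>R iexp (t * \<eta>))"
    unfolding char_def by (subst integral_density) (auto simp: normal_density_nonneg)
  finally show ?thesis by (simp add: scaleR_conv_of_real)
qed

text \<open>Writing the Gaussian as a Fourier integral and exchanging the integrals expresses a Gaussian
  average of \<open>f\<close> through the Fourier transform of \<open>f\<close>.\<close>

lemma gaussian_average_via_fourier:
  assumes f: "integrable lebesgue f" and s: "s > 0"
  shows "(LINT x|lebesgue. f x * complex_of_real (exp (- ((x - y) / s)\<^sup>2 / 2))) =
    (LINT \<eta>|lborel. std_normal_density \<eta> * iexp (- y / s * \<eta>) * fourier f (- \<eta> / (2 * pi * s)))"
proof -
  interpret sigma_finite_measure "lebesgue :: real measure" by (rule sigma_finite_lebesgue)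
  interpret pair_sigma_finite "lebesgue :: real measure" "lborel :: real measure"
    by unfold_locales
  have [measurable]: "f \<in> borel_measurable lebesgue" using f by simp
  define F where "F x \<eta> = f x * (std_normal_density \<eta> * iexp ((x - y) / s * \<eta>))" for x \<eta>
  have F: "integrable (lebesgue \<Otimes>\<^sub>M lborel) (case_prod F)"
  proof (rule integrable_pair_bound)
    show "case_prod F \<in> borel_measurable (lebesgue \<Otimes>\<^sub>M lborel)" unfolding F_def by measurable
    show "integrable lebesgue (\<lambda>x. norm (f x))" using f by simp
    show "integrable lborel std_normal_density" by simp
    show "norm (F x \<eta>) \<le> norm (f x) * std_normal_density \<eta>" for x \<eta>
      by (simp add: F_def norm_mult normal_density_nonneg)
  qed
  have "(LINT x|lebesgue. f x * complex_of_real (exp (- ((x - y) / s)\<^sup>2 / 2))) =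
      (LINT x|lebesgue. LINT \<eta>|lborel. F x \<eta>)"
    unfolding F_def gaussian_eq_fourier_integral by simp
  also have "\<dots> = (LINT \<eta>|lborel. LINT x|lebesgue. F x \<eta>)"
    by (rule Fubini_integral[OF F, symmetric])
  also have "\<dots> = (LINT \<eta>|lborel. std_normal_density \<eta> * iexp (- y / s * \<eta>) * fourier f (- \<eta> / (2 * pi * s)))"
  proof (intro Bochner_Integration.integral_cong refl)
    fix \<eta> :: real
    have "F x \<eta> = (std_normal_density \<eta> * iexp (- y / s * \<eta>)) *
        (f x * exp (- 2 * of_real pi * \<i> * of_real x * of_real (- \<eta> / (2 * pi * s))))" for x
    proof -
      have "\<i> * complex_of_real ((x - y) / s * \<eta>) = \<i> * complex_of_real (- y / s * \<eta>) +
          (- 2 * of_real pi * \<i> * of_real x * of_real (- \<eta> / (2 * pi * s)))"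
        using s by (simp add: field_simps)
      then show ?thesis by (simp only: F_def exp_add mult_ac)
    qed
    then show "(LINT x|lebesgue. F x \<eta>) = std_normal_density \<eta> * iexp (- y / s * \<eta>) * fourier f (- \<eta> / (2 * pi * s))"
      by (simp add: fourier_def)
  qed
  finally show ?thesis .
qed

text \<open>With normalised Gaussians the bound does not depend on the width \<open>s\<close>: the factor
  \<open>1 / (sqrt (2 * pi) * s)\<close> of the density cancels against the substitution \<open>\<xi> = - \<eta> / (2 * pi * s)\<close>
  and the maximum \<open>1 / sqrt (2 * pi)\<close> of the standard normal density.\<close>

lemma norm_normal_average_le_fourier_L1:
  assumes f: "integrable lebesgue f" and F: "integrable lebesgue (fourier f)" and s: "s > 0"
  shows "norm (LINT x|lebesgue. f x * complex_of_real (normal_density y s x)) \<le> (LINT \<xi>|lebesgue. norm (fourier f \<xi>))"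
proof -
  have Fm[measurable]: "fourier f \<in> borel_measurable borel" by (rule borel_measurable_fourier[OF f])
  define c where "c = - 1 / (2 * pi * s)"
  have c: "c \<noteq> 0" "\<bar>c\<bar> = 1 / (2 * pi * s)" using s by (auto simp: c_def)
  have Fl: "integrable lborel (\<lambda>\<xi>. norm (fourier f \<xi>))"
    using F by (simp add: integrable_completion)
  have Fc: "integrable lborel (\<lambda>\<eta>. norm (fourier f (0 + c * \<eta>)))"
    by (rule lborel_integrable_real_affine[OF Fl c(1)])
  have FL: "(LINT \<xi>|lebesgue. norm (fourier f \<xi>)) = (1 / (2 * pi * s)) * (LINT \<eta>|lborel. norm (fourier f (0 + c * \<eta>)))"
    using lborel_integral_real_affine[OF c(1), of "\<lambda>\<xi>. norm (fourier f \<xi>)" 0] c(2)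
    by (simp add: integral_completion)
  have dens: "std_normal_density \<eta> \<le> 1 / sqrt (2 * pi)" for \<eta>
    unfolding std_normal_density_def by (rule mult_right_le_one_le) auto
  have "norm (LINT x|lebesgue. f x * complex_of_real (exp (- ((x - y) / s)\<^sup>2 / 2))) \<le>
      (LINT \<eta>|lborel. norm (std_normal_density \<eta> * iexp (- y / s * \<eta>) * fourier f (- \<eta> / (2 * pi * s))))"
    unfolding gaussian_average_via_fourier[OF f s] by (rule integral_norm_bound)
  also have "\<dots> \<le> (LINT \<eta>|lborel. 1 / sqrt (2 * pi) * norm (fourier f (0 + c * \<eta>)))"
  proof (rule integral_mono')
    show "integrable lborel (\<lambda>\<eta>. 1 / sqrt (2 * pi) * norm (fourier f (0 + c * \<eta>)))"
      using Fc by (rule integrable_mult_right)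
    fix \<eta> :: real
    have "norm (std_normal_density \<eta> * iexp (- y / s * \<eta>) * fourier f (- \<eta> / (2 * pi * s))) =
        std_normal_density \<eta> * norm (fourier f (0 + c * \<eta>))"
      by (simp add: norm_mult normal_density_nonneg c_def)
    also have "\<dots> \<le> 1 / sqrt (2 * pi) * norm (fourier f (0 + c * \<eta>))"
      by (rule mult_right_mono[OF dens]) simp
    finally show "norm (std_normal_density \<eta> * iexp (- y / s * \<eta>) * fourier f (- \<eta> / (2 * pi * s))) \<le>
        1 / sqrt (2 * pi) * norm (fourier f (0 + c * \<eta>))" .
  qed simp
  also have "\<dots> = 1 / sqrt (2 * pi) * (2 * pi * s * (LINT \<xi>|lebesgue. norm (fourier f \<xi>)))"
    unfolding FL using s by simp
  also have "\<dots> = sqrt (2 * pi) * s * (LINT \<xi>|lebesgue. norm (fourier f \<xi>))"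
  proof -
    have "1 / sqrt (2 * pi) * (2 * pi) = sqrt (2 * pi)"
      using real_div_sqrt[of "2 * pi"] by simp
    then show ?thesis by (simp only: mult.assoc[symmetric])
  qed
  finally have gauss: "norm (LINT x|lebesgue. f x * complex_of_real (exp (- ((x - y) / s)\<^sup>2 / 2))) \<le>
      sqrt (2 * pi) * s * (LINT \<xi>|lebesgue. norm (fourier f \<xi>))" .
  have norm_const: "(LINT x|lebesgue. f x * complex_of_real (normal_density y s x)) =
      complex_of_real (1 / (sqrt (2 * pi) * s)) * (LINT x|lebesgue. f x * complex_of_real (exp (- ((x - y) / s)\<^sup>2 / 2)))"
  proof -
    have "normal_density y s x = 1 / (sqrt (2 * pi) * s) * exp (- ((x - y) / s)\<^sup>2 / 2)" for x
      using s by (simp add: normal_density_def real_sqrt_mult power_divide mult.commute)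
    then have "f x * complex_of_real (normal_density y s x) = complex_of_real (1 / (sqrt (2 * pi) * s)) *
        (f x * complex_of_real (exp (- ((x - y) / s)\<^sup>2 / 2)))" for x
      by (simp only: of_real_mult mult.left_commute)
    then show ?thesis by (simp only: integral_mult_right_zero)
  qed
  have c': "1 / (sqrt (2 * pi) * s) > 0" using s by simp
  have "norm (LINT x|lebesgue. f x * complex_of_real (normal_density y s x)) =
      1 / (sqrt (2 * pi) * s) * norm (LINT x|lebesgue. f x * complex_of_real (exp (- ((x - y) / s)\<^sup>2 / 2)))"
    by (simp only: norm_const norm_mult norm_of_real abs_of_pos[OF c'])
  also have "\<dots> \<le> 1 / (sqrt (2 * pi) * s) * (sqrt (2 * pi) * s * (LINT \<xi>|lebesgue. norm (fourier f \<xi>)))"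
    using gauss c' by (intro mult_left_mono) auto
  also have "\<dots> = (LINT \<xi>|lebesgue. norm (fourier f \<xi>))" using s by simp
  finally show ?thesis .
qed

lemma normal_average_rescale:
  assumes s: "s > 0"
  shows "(LINT y|lborel. v y * normal_density y s x) = (LINT z|lborel. v (x + s * z) * std_normal_density z)"
proof -
  have "(LINT y|lborel. v y * normal_density y s x) =
      s * (LINT z|lborel. v (x + s * z) * normal_density (x + s * z) s x)"
    using s lborel_integral_real_affine[of s "\<lambda>y. v y * normal_density y s x" x] by simp
  also have "\<dots> = (LINT z|lborel. v (x + s * z) * (s * normal_density (x + s * z) s x))"
    by (simp only: mult.left_commute integral_mult_right_zero)
  also have "\<dots> = (LINT z|lborel. v (x + s * z) * std_normal_density z)"
  proof -
    have "s * normal_density (x + s * z) s x = std_normal_density z" for z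
      using s by (simp add: normal_density_def real_sqrt_mult power_mult_distrib)
    then show ?thesis by (simp only:)
  qed
  finally show ?thesis .
qed

lemma normal_average_tendsto:
  fixes v :: "real \<Rightarrow> real"
  assumes cont: "continuous_on UNIV v" and v: "\<And>x. 0 \<le> v x" "\<And>x. v x \<le> 1"
    and \<sigma>: "\<And>n. \<sigma> n > 0" "\<sigma> \<longlonglongrightarrow> 0"
  shows "(\<lambda>n. LINT y|lborel. v y * normal_density y (\<sigma> n) x) \<longlonglongrightarrow> v x"
proof -
  have [measurable]: "v \<in> borel_measurable borel" using cont by (rule borel_measurable_continuous_onI)
  have "(\<lambda>n. LINT z|lborel. v (x + \<sigma> n * z) * std_normal_density z) \<longlonglongrightarrow> (LINT z|lborel. v x * std_normal_density z)"
  proof (rule integral_dominated_convergence[where w=std_normal_density])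
    show "AE z in lborel. (\<lambda>n. v (x + \<sigma> n * z) * std_normal_density z) \<longlonglongrightarrow> v x * std_normal_density z"
    proof (intro AE_I2 tendsto_mult tendsto_const)
      fix z
      have "isCont v x" using cont by (simp add: continuous_on_eq_continuous_at)
      moreover have "(\<lambda>n. x + \<sigma> n * z) \<longlonglongrightarrow> x" using \<sigma>(2) by (auto intro!: tendsto_eq_intros)
      ultimately show "(\<lambda>n. v (x + \<sigma> n * z)) \<longlonglongrightarrow> v x" by (rule isCont_tendsto_compose)
    qed
    show "AE z in lborel. norm (v (x + \<sigma> n * z) * std_normal_density z) \<le> std_normal_density z" for n
      using v by (intro AE_I2) (simp add: abs_mult normal_density_nonneg mult_left_le_one_le)
  qed auto
  then show ?thesis using \<sigma>(1) by (simp add: normal_average_rescale)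
qed

text \<open>Averaging the previous bound over the centre \<open>y\<close> with weight \<open>v\<close> and moving the Gaussian from
  \<open>f\<close> to \<open>v\<close> by Fubini leaves an average of \<open>v\<close>, which tends to \<open>v\<close> pointwise as the width shrinks
  because \<open>v\<close> is continuous.\<close>

lemma norm_integral_continuous_le:
  fixes v :: "real \<Rightarrow> real"
  assumes f: "integrable lebesgue f" and F: "integrable lebesgue (fourier f)"
    and cont: "continuous_on UNIV v" and v: "\<And>x. 0 \<le> v x" "\<And>x. v x \<le> 1" and vi: "integrable lborel v"
  shows "norm (LINT x|lebesgue. f x * complex_of_real (v x)) \<le> (LINT \<xi>|lebesgue. norm (fourier f \<xi>)) * (LINT y|lborel. v y)"
proof -
  interpret L: sigma_finite_measure "lebesgue :: real measure" by (rule sigma_finite_lebesgue)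
  interpret pair_sigma_finite "lebesgue :: real measure" "lborel :: real measure"
    by unfold_locales
  have [measurable]: "f \<in> borel_measurable lebesgue" using f by simp
  have vm[measurable]: "v \<in> borel_measurable borel" using cont by (rule borel_measurable_continuous_onI)
  define C where "C = (LINT \<xi>|lebesgue. norm (fourier f \<xi>))"
  define avg where "avg s x = (LINT y|lborel. v y * normal_density y s x)" for s x
  have [measurable]: "(\<lambda>z. normal_density (snd z) s (fst z)) \<in> borel_measurable (borel \<Otimes>\<^sub>M borel)" for s
    unfolding normal_density_def by measurable
  have avg_m: "avg s \<in> borel_measurable lebesgue" for s
    unfolding avg_def[abs_def] by (intro measurable_completion) measurable
  have avg_le: "\<bar>avg s x\<bar> \<le> 1" if "s > 0" for s x
  proof -
    have "\<bar>avg s x\<bar> \<le> (LINT z|lborel. \<bar>v (x + s * z) * std_normal_density z\<bar>)"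
      unfolding avg_def normal_average_rescale[OF that] by (rule integral_abs_bound)
    also have "\<dots> \<le> (LINT z|lborel. std_normal_density z)"
      using v by (intro integral_mono') (auto simp: abs_mult normal_density_nonneg mult_left_le_one_le)
    finally show ?thesis by simp
  qed
  have bound: "norm (LINT x|lebesgue. f x * complex_of_real (avg s x)) \<le> C * (LINT y|lborel. v y)" if s: "s > 0" for s
  proof -
    define G where "G x y = f x * (complex_of_real (v y) * complex_of_real (normal_density y s x))" for x y
    have G: "integrable (lebesgue \<Otimes>\<^sub>M lborel) (case_prod G)"
    proof (rule integrable_pair_bound)
      show "case_prod G \<in> borel_measurable (lebesgue \<Otimes>\<^sub>M lborel)"
        unfolding G_def normal_density_def by measurable
      show "integrable lebesgue (\<lambda>x. norm (f x))" using f by simp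
      show "integrable lborel (\<lambda>y. v y * (1 / sqrt (2 * pi * s\<^sup>2)))" using vi by simp
      show "norm (G x y) \<le> norm (f x) * (v y * (1 / sqrt (2 * pi * s\<^sup>2)))" for x y
      proof -
        have "normal_density y s x \<le> 1 / sqrt (2 * pi * s\<^sup>2)"
          unfolding normal_density_def by (rule mult_right_le_one_le) auto
        then have "v y * normal_density y s x \<le> v y * (1 / sqrt (2 * pi * s\<^sup>2))"
          using v(1)[of y] by (rule mult_left_mono)
        then have "norm (f x) * (v y * normal_density y s x) \<le> norm (f x) * (v y * (1 / sqrt (2 * pi * s\<^sup>2)))"
          by (rule mult_left_mono) simp
        moreover have "norm (G x y) = norm (f x) * (v y * normal_density y s x)"
          using v(1)[of y] by (simp add: G_def norm_mult)
        ultimately show ?thesis by simp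
      qed
    qed
    have "(LINT x|lebesgue. f x * complex_of_real (avg s x)) = (LINT x|lebesgue. LINT y|lborel. G x y)"
      unfolding G_def avg_def by (simp flip: integral_complex_of_real of_real_mult)
    also have "\<dots> = (LINT y|lborel. LINT x|lebesgue. G x y)"
      by (rule Fubini_integral[OF G, symmetric])
    also have "\<dots> = (LINT y|lborel. v y * (LINT x|lebesgue. f x * complex_of_real (normal_density y s x)))"
    proof -
      have "G x y = complex_of_real (v y) * (f x * complex_of_real (normal_density y s x))" for x y
        by (simp add: G_def mult.left_commute)
      then show ?thesis by (simp only: integral_mult_right_zero)
    qed
    also have "norm \<dots> \<le> (LINT y|lborel. norm (v y * (LINT x|lebesgue. f x * complex_of_real (normal_density y s x))))"
      by (rule integral_norm_bound)
    also have "\<dots> \<le> (LINT y|lborel. C * v y)"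
    proof (rule integral_mono')
      show "integrable lborel (\<lambda>y. C * v y)" using vi by simp
      show "norm (v y * (LINT x|lebesgue. f x * complex_of_real (normal_density y s x))) \<le> C * v y" for y
        using norm_normal_average_le_fourier_L1[OF f F s, of y] v(1)[of y]
        by (simp add: norm_mult C_def mult_right_mono mult.commute[of "v y"])
    qed (use v(1) in \<open>simp add: C_def\<close>)
    finally show ?thesis by simp
  qed
  define \<sigma> where "\<sigma> n = 1 / real (Suc n)" for n
  have \<sigma>: "\<sigma> n > 0" "\<sigma> \<longlonglongrightarrow> 0" for n
    unfolding \<sigma>_def[abs_def] by (simp, rule LIMSEQ_Suc[OF lim_inverse_n'])
  have "(\<lambda>n. LINT x|lebesgue. f x * complex_of_real (avg (\<sigma> n) x)) \<longlonglongrightarrow> (LINT x|lebesgue. f x * complex_of_real (v x))"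
  proof (rule integral_dominated_convergence[where w="\<lambda>x. norm (f x)"])
    show "(\<lambda>x. f x * complex_of_real (v x)) \<in> borel_measurable lebesgue"
      using measurable_completion[of v lborel borel] f vm
      by (intro borel_measurable_times borel_measurable_of_real) auto
    show "(\<lambda>x. f x * complex_of_real (avg (\<sigma> n) x)) \<in> borel_measurable lebesgue" for n
      using f avg_m[of "\<sigma> n"] by (intro borel_measurable_times borel_measurable_of_real) auto
    show "integrable lebesgue (\<lambda>x. norm (f x))" using f by simp
    show "AE x in lebesgue. (\<lambda>n. f x * complex_of_real (avg (\<sigma> n) x)) \<longlonglongrightarrow> f x * complex_of_real (v x)"
      unfolding avg_def
      by (intro AE_I2 tendsto_mult tendsto_const tendsto_of_real normal_average_tendsto[OF cont v \<sigma>])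
    show "AE x in lebesgue. norm (f x * complex_of_real (avg (\<sigma> n) x)) \<le> norm (f x)" for n
      using avg_le[OF \<sigma>(1)] by (intro AE_I2) (simp add: norm_mult mult_right_le_one_le)
  qed
  then have "(\<lambda>n. norm (LINT x|lebesgue. f x * complex_of_real (avg (\<sigma> n) x))) \<longlonglongrightarrow> norm (LINT x|lebesgue. f x * complex_of_real (v x))"
    by (rule tendsto_norm)
  then have "norm (LINT x|lebesgue. f x * complex_of_real (v x)) \<le> C * (LINT y|lborel. v y)"
    by (rule LIMSEQ_le_const2) (use bound[OF \<sigma>(1)] in blast)
  then show ?thesis by (simp add: C_def)
qed

text \<open>The substitute for Fourier inversion. Indicator functions of measurable sets are almost everywhere
  limits of continuous functions, so the bound for continuous weights passes to averages over sets
  and hence to points.\<close>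

lemma AE_norm_le_fourier_L1:
  assumes f: "integrable lebesgue f" and F: "integrable lebesgue (fourier f)"
  shows "AE x in lebesgue. norm (f x) \<le> (LINT \<xi>|lebesgue. norm (fourier f \<xi>))"
proof (rule AE_lebesgue_norm_le_of_set_averages)
  fix n :: nat
  show "integrable lebesgue (\<lambda>x. indicator {- real n..real n} x *\<^sub>R f x)"
    using f by (intro integrable_mult_indicator) auto
next
  fix A :: "real set" assume A: "A \<in> sets lebesgue" "bounded A"
  define C where "C = (LINT \<xi>|lebesgue. norm (fourier f \<xi>))"
  obtain N g where N: "negligible N" and g: "\<And>n. continuous_on UNIV (g n)"
    "\<And>x. x \<notin> N \<Longrightarrow> (\<lambda>n. g n x) \<longlonglongrightarrow> indicat_real A x"
    using indicator_measurable_on[OF A(1)] unfolding measurable_on_def by auto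
  obtain m where m: "\<And>x. x \<in> A \<Longrightarrow> \<bar>x\<bar> \<le> m" using A(2) by (auto simp: bounded_iff)
  \<comment> \<open>Clamping to \<open>{0..1}\<close> and cutting off near \<open>A\<close> gives the approximants a common integrable majorant.\<close>
  define bump where "bump x = max 0 (min 1 (m + 1 - \<bar>x\<bar>))" for x :: real
  define v where "v n x = min 1 (max 0 (g n x)) * bump x" for n x
  have bump: "0 \<le> bump x" "bump x \<le> 1" for x by (auto simp: bump_def)
  have v: "continuous_on UNIV (v n)" "0 \<le> v n x" "v n x \<le> 1" "\<bar>v n x\<bar> \<le> bump x" for n x
    unfolding v_def using bump[of x] g(1)
    by (auto simp: bump_def intro!: continuous_intros mult_le_one mult_left_le_one_le)
  have [measurable]: "bump \<in> borel_measurable borel" unfolding bump_def by measurable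
  have vm[measurable]: "v n \<in> borel_measurable borel" for n using v(1) by (rule borel_measurable_continuous_onI)
  have bump_int: "integrable lborel bump"
  proof (rule Bochner_Integration.integrable_bound)
    show "integrable lborel (indicat_real {-(m+1)..m+1})" by (intro integrable_real_indicator) (auto simp: emeasure_lborel_Icc_eq)
    show "AE x in lborel. norm (bump x) \<le> norm (indicat_real {-(m+1)..m+1} x)"
      by (intro AE_I2) (auto simp: bump_def split: split_indicator)
  qed simp
  have vi: "integrable lborel (v n)" for n
    by (rule Bochner_Integration.integrable_bound[OF bump_int]) (use v(4) bump in \<open>auto intro!: AE_I2\<close>)
  have N0: "AE x in lebesgue. x \<notin> N"
    using N by (intro AE_not_in) (simp add: negligible_iff_null_sets)
  have lim: "(\<lambda>n. v n x) \<longlonglongrightarrow> indicat_real A x" if "x \<notin> N" for x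
  proof -
    have "(\<lambda>n. v n x) \<longlonglongrightarrow> min 1 (max 0 (indicat_real A x)) * bump x"
      unfolding v_def using g(2)[OF that] by (intro tendsto_intros)
    moreover have "min 1 (max 0 (indicat_real A x)) * bump x = indicat_real A x"
      using m[of x] by (auto simp: bump_def split: split_indicator)
    ultimately show ?thesis by (simp only:)
  qed
  have fA: "(\<lambda>x. f x * complex_of_real (indicat_real A x)) \<in> borel_measurable lebesgue"
    using f A(1) by (intro borel_measurable_times borel_measurable_of_real) auto
  have vL: "v n \<in> borel_measurable lebesgue" for n by (intro measurable_completion) simp
  have 1: "(\<lambda>n. LINT x|lebesgue. f x * complex_of_real (v n x)) \<longlonglongrightarrow> (LINT x|lebesgue. f x * complex_of_real (indicat_real A x))"
  proof (rule integral_dominated_convergence[where w="\<lambda>x. norm (f x)"])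
    show "AE x in lebesgue. (\<lambda>n. f x * complex_of_real (v n x)) \<longlonglongrightarrow> f x * complex_of_real (indicat_real A x)"
      using N0 by eventually_elim (intro tendsto_intros lim)
    show "AE x in lebesgue. norm (f x * complex_of_real (v n x)) \<le> norm (f x)" for n
      using v(2,3) by (intro AE_I2) (simp add: norm_mult mult_right_le_one_le)
    show "(\<lambda>x. f x * complex_of_real (v n x)) \<in> borel_measurable lebesgue" for n
      using f vL by (intro borel_measurable_times borel_measurable_of_real) auto
  qed (use f fA in auto)
  have 2: "(\<lambda>n. LINT x|lebesgue. v n x) \<longlonglongrightarrow> (LINT x|lebesgue. indicat_real A x)"
  proof (rule integral_dominated_convergence[where w=bump])
    show "integrable lebesgue bump" using bump_int by (simp add: integrable_completion)
    show "AE x in lebesgue. (\<lambda>n. v n x) \<longlonglongrightarrow> indicat_real A x"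
      using N0 by eventually_elim (rule lim)
  qed (use A v vL in auto)
  have "norm (LINT x|lebesgue. f x * complex_of_real (v n x)) \<le> C * (LINT x|lebesgue. v n x)" for n
    using norm_integral_continuous_le[OF f F v(1-3) vi] by (simp add: C_def integral_completion)
  then have "norm (LINT x|lebesgue. f x * complex_of_real (indicat_real A x)) \<le> C * (LINT x|lebesgue. indicat_real A x)"
    using tendsto_norm[OF 1] tendsto_mult_left[OF 2, of C] by (blast intro: LIMSEQ_le)
  then show "norm (LINT x:A|lebesgue. f x) \<le> C * measure lebesgue A"
    using A(1) by (simp add: set_lebesgue_integral_def scaleR_conv_of_real mult.commute)
qed simp

text \<open>Both parts are instances of \<open>variance_product_ge\<close>; the Fourier transform satisfies its mutual
  bounds with \<open>k = 1\<close>, so the power of \<open>k\<close> disappears there.\<close>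

theorem theorem4p11:
  shows "(\<forall>(k::real) (A :: (real \<Rightarrow> complex) \<Rightarrow> (real \<Rightarrow> complex)) (f :: real \<Rightarrow> complex) (q::ereal).
            k > 0 \<longrightarrow> hadamard k A \<longrightarrow> doubly_L1 A f \<longrightarrow> 1 < q \<longrightarrow>
            variance_on_R f * variance_on_R (A f) \<ge>
              ennreal (C_const q * k powr k_exponent q) * (Lq_norm q f)\<^sup>2 * (Lq_norm q (A f))\<^sup>2)
       \<and> (\<forall>(f :: real \<Rightarrow> complex) (q::ereal).
            f \<in> L1_space \<longrightarrow> fourier f \<in> L1_space \<longrightarrow> 1 < q \<longrightarrow>
            variance_on_R f * variance_on_R (fourier f) \<ge>
              ennreal (C_const q) * (Lq_norm q f)\<^sup>2 * (Lq_norm q (fourier f))\<^sup>2)"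
proof (intro conjI allI impI)
  fix k :: real and A :: "(real \<Rightarrow> complex) \<Rightarrow> (real \<Rightarrow> complex)" and f :: "real \<Rightarrow> complex" and q :: ereal
  assume k: "k > 0" and A: "hadamard k A" and f: "doubly_L1 A f" and q: "1 < q"
  have "integrable lebesgue f" "integrable lebesgue (A f)"
    using f by (auto simp: doubly_L1_def L1_space_def)
  then show "variance_on_R f * variance_on_R (A f) \<ge>
      ennreal (C_const q * k powr k_exponent q) * (Lq_norm q f)\<^sup>2 * (Lq_norm q (A f))\<^sup>2"
    by (rule variance_product_ge[OF _ _ k q hadamard_bounds[OF k A f]])
next
  fix f :: "real \<Rightarrow> complex" and q :: ereal
  assume "f \<in> L1_space" "fourier f \<in> L1_space" and q: "1 < q"
  then have f: "integrable lebesgue f" "integrable lebesgue (fourier f)" by (auto simp: L1_space_def)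
  show "variance_on_R f * variance_on_R (fourier f) \<ge>
      ennreal (C_const q) * (Lq_norm q f)\<^sup>2 * (Lq_norm q (fourier f))\<^sup>2"
    using variance_product_ge[OF f, of 1 q] norm_fourier_le[OF f(1)] AE_norm_le_fourier_L1[OF f] q by simp
qed

end
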